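(* Let $f$ satisfy the $(2r,4r)$-restricted strong convexity and smoothness properties with parameter $\delta\in[0,1)$. Let $\mu,\alpha,\beta,\gamma\ge0$ and let $\mathcal{R}_2$ be the set of all $\mathbf{Y}\in\mathbb{R}^{p\times r}_*$ with $$d([\mathbf{Y}],[\mathbf{Y}^*])>\mu\sigma_r(\mathbf{Y}^* )/\kappa^*,\quad\|\overline{\mathrm{grad}\,H([\mathbf{Y}])}\|_F\le\alpha\mu\sigma_r^3(\mathbf{Y}^* )/(4\kappa^* ),\quad\|\mathbf{Y}\|\le\beta\|\mathbf{Y}^*\|,\quad\|\mathbf{Y}\mathbf{Y}^\top\|_F\le\gamma\|\mathbf{Y}^*\mathbf{Y}^{*\top}\|_F .$$ Given any $\mathbf{Y}\in\mathcal{R}_2$, let $\theta_{\mathbf{Y}}=\mathbf{Y}-\mathbf{Y}^*\mathbf{Q}$, where $\mathbf{Q}\in\arg\min_{\mathbf{O}\in\mathbb{O}_r}\|\mathbf{Y}^*\mathbf{O}-\mathbf{Y}\|_F$. Then $$\overline{\mathrm{Hess}\,h([\mathbf{Y}])}[\theta_{\mathbf{Y}},\theta_{\mathbf{Y}}]\le\Big((\alpha-2(\sqrt2-1))\sigma_r^2(\mathbf{Y}^* )+2\delta\big(2\beta^2\|\mathbf{Y}^*\|^2+(1+\gamma)\|\mathbf{Y}^*\mathbf{Y}^{*\top}\|_F\big)+2\|(\nabla f(\mathbf{X}^* ))_{\max(r)}\|_F\Big)\|\theta_{\mathbf{Y}}\|_F^2 .$$ In particular, if $\alpha<2(\sqrt2-1)$,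 $$\delta\le\frac{(2(\sqrt2-1)-\alpha)\sigma_r^2(\mathbf{Y}^* )}{8\big(2\beta^2\|\mathbf{Y}^*\|^2+(1+\gamma)\|\mathbf{Y}^*\mathbf{Y}^{*\top}\|_F\big)}\quad\text{and}\quad\|(\nabla f(\mathbf{X}^* ))_{\max(r)}\|_F\le\frac{2(\sqrt2-1)-\alpha}{8}\sigma_r^2(\mathbf{Y}^* ),$$ then $$\overline{\mathrm{Hess}\,h([\mathbf{Y}])}[\theta_{\mathbf{Y}},\theta_{\mathbf{Y}}]\le\frac{\alpha-2(\sqrt2-1)}{2}\sigma_r^2(\mathbf{Y}^* )\|\theta_{\mathbf{Y}}\|_F^2<0,$$ so $\overline{\mathrm{Hess}\,h([\mathbf{Y}])}$ has at least one negative eigenvalue and $\theta_{\mathbf{Y}}$ is an escaping direction (a direction of negative curvature).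
   Context: Let $0<r\le p$ be integers. $\|\cdot\|$ and $\|\cdot\|_F$ are the spectral and Frobenius norms, $\sigma_i(\cdot)$ is the $i$-th largest singular value, and $\mathbf{A}_{\max(r)}$ is the best rank-$r$ approximation of $\mathbf{A}$ in Frobenius norm (truncated SVD). $\mathbb{R}^{p\times r}_*$ is the set of real $p\times r$ matrices of full column rank and $\mathbb{O}_r$ is the orthogonal group. Quotient geometry: $\mathcal{M}:=\mathbb{R}^{p\times r}_*/\mathbb{O}_r$ has points $[\mathbf{Y}]=\{\mathbf{Y}\mathbf{O}:\mathbf{O}\in\mathbb{O}_r\}$ and carries the Riemannian metric induced from $\bar g_{\mathbf{Y}}(\eta,\theta)=\mathrm{tr}(\eta^\top\theta)$; tangent vectors at $[\mathbf{Y}]$ are represented by horizontal lifts in $\mathcal{H}_{\mathbf{Y}}=\{\theta\in\mathbb{R}^{p\times r}:\mathbf{Y}^\top\theta\text{ symmetric}\}$. The geodesic distance is $d([\mathbf{Y}_1],[\mathbf{Y}_2])=\min_{\mathbf{Q}\in\mathbb{O}_r}\|\mathbf{Y}_2\mathbf{Q}-\mathbf{Y}_1\|_F$. Objective: $f:\mathbb{R}^{p\times p}\to\mathbb{R}$ is twice continuously differentiable with $f(\mathbf{X})=f(\mathbf{X}^\top)$, with Euclidean gradient $\nabla f$ and Hessian bilinear form $\nabla^2f(\mathbf{X})[\cdot,\cdot]$. $f$ satisfies the $(2r,4r)$-restricted strong convexity and smoothness properties with parameter $0\le\delta<1$ if $(1-\delta)\|\mathbf{G}\|_F^2\le\nabla^2f(\mathbf{X})[\mathbf{G},\mathbf{G}]\le(1+\delta)\|\mathbf{G}\|_F^2$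 for all $\mathbf{X},\mathbf{G}\in\mathbb{R}^{p\times p}$ with $\mathrm{rank}(\mathbf{X})\le2r$, $\mathrm{rank}(\mathbf{G})\le4r$. Define $h([\mathbf{Y}])=f(\mathbf{Y}\mathbf{Y}^\top)$ on $\mathcal{M}$; the lifted Riemannian Hessian is $\overline{\mathrm{Hess}\,h([\mathbf{Y}])}[\theta,\theta]=\nabla^2f(\mathbf{Y}\mathbf{Y}^\top)[\mathbf{Y}\theta^\top+\theta\mathbf{Y}^\top,\mathbf{Y}\theta^\top+\theta\mathbf{Y}^\top]+2\langle\nabla f(\mathbf{Y}\mathbf{Y}^\top),\theta\theta^\top\rangle$ for $\theta\in\mathcal{H}_{\mathbf{Y}}$. Target: $\mathbf{X}^*\in\mathbb{R}^{p\times p}$ is a fixed symmetric positive semidefinite matrix of rank $r$ with reduced eigendecomposition $\mathbf{U}^*\boldsymbol{\Sigma}^*\mathbf{U}^{*\top}$; $\mathbf{Y}^*=\mathbf{U}^*\boldsymbol{\Sigma}^{*1/2}$, $\kappa^*=\sigma_1(\mathbf{Y}^* )/\sigma_r(\mathbf{Y}^* )$. Also $H([\mathbf{Y}])=\frac12\|\mathbf{Y}\mathbf{Y}^\top-\mathbf{X}^*\|_F^2$ on $\mathcal{M}$, whose lifted Riemannian gradient is $\overline{\mathrm{grad}\,H([\mathbf{Y}])}=2(\mathbf{Y}\mathbf{Y}^\top-\mathbf{X}^* )\mathbf{Y}$. *)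

theory Defs
  imports "HOL-Analysis.Analysis"
begin

text \<open>
  A real matrix with rows indexed by 'p and columns by 'r has type real^'r^'p. On this type
  the library's norm is the Frobenius norm, and the library's inner product is
  trace (transpose A ** B); see \<open>inner_matrix_trace\<close> below.
\<close>

lemma inner_matrix_trace:
  fixes A B :: "real^'n^'m"
  shows "A \<bullet> B = trace (transpose A ** B)"
  unfolding inner_vec_def trace_def matrix_matrix_mult_def transpose_def
  by simp (rule sum.swap)

definition spectral_norm :: "real^'n^'m \<Rightarrow> real" where
  "spectral_norm A = onorm ((*v) A)"

text \<open>
  The singular values of an m x n matrix A in decreasing order: the numbers s \<ge> 0 such that
  s^2 is an eigenvalue of transpose A ** A, each repeated according to the dimension of its
  eigenspace. The list has length n; for n > m it ends with n - m zeros in addition to the usual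
  min(m, n) singular values.
\<close>

definition singular_values :: "real^'n^'m \<Rightarrow> real list" where
  "singular_values A = (THE xs. sorted_wrt (\<ge>) xs \<and>
     (\<forall>s. count_list xs s =
        (if 0 \<le> s then dim {v. (transpose A ** A) *v v = s\<^sup>2 *\<^sub>R v} else 0)))"

definition sing_val :: "nat \<Rightarrow> real^'n^'m \<Rightarrow> real" where
  "sing_val i A = singular_values A ! (i - 1)"

text \<open>
  B is a truncated singular value decomposition of A at rank k. B need not be unique if the k-th
  and (k+1)-st singular values of A agree, but its Frobenius norm is.
\<close>

definition best_rank_approx :: "nat \<Rightarrow> real^'n^'m \<Rightarrow> real^'n^'m \<Rightarrow> bool" where
  "best_rank_approx k A B \<longleftrightarrow> is_arg_min (\<lambda>C. norm (A - C)) (\<lambda>C. rank C \<le> k) B"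

definition full_col_rank :: "(real^'r^'p) set" where
  "full_col_rank = {Y. rank Y = CARD('r)}"

definition diag_mat :: "real^'n \<Rightarrow> real^'n^'n" where
  "diag_mat s = (\<chi> i j. if i = j then s $ i else 0)"

definition sym_psd :: "real^'n^'n \<Rightarrow> bool" where
  "sym_psd A \<longleftrightarrow> transpose A = A \<and> (\<forall>v. 0 \<le> v \<bullet> (A *v v))"

text \<open>The vector s holds the nonzero eigenvalues, i.e. the diagonal of the middle factor.\<close>

definition reduced_eigendecomp :: "real^'p^'p \<Rightarrow> real^'r^'p \<Rightarrow> real^'r \<Rightarrow> bool" where
  "reduced_eigendecomp A U s \<longleftrightarrow>
     transpose U ** U = mat 1 \<and> (\<forall>i. 0 < s $ i) \<and> A = U ** diag_mat s ** transpose U"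

definition gradient :: "('a::euclidean_space \<Rightarrow> real) \<Rightarrow> 'a \<Rightarrow> 'a" where
  "gradient f x = (THE D. GDERIV f x :> D)"

definition hessian_form :: "('a::euclidean_space \<Rightarrow> real) \<Rightarrow> 'a \<Rightarrow> 'a \<Rightarrow> 'a \<Rightarrow> real" where
  "hessian_form f x u v = frechet_derivative (gradient f) (at x) u \<bullet> v"

definition twice_cont_diff :: "('a::euclidean_space \<Rightarrow> real) \<Rightarrow> bool" where
  "twice_cont_diff f \<longleftrightarrow> (\<forall>x. f differentiable (at x)) \<and>
     (\<exists>f''. (\<forall>x. (gradient f has_derivative blinfun_apply (f'' x)) (at x)) \<and>
            continuous_on UNIV f'')"

definition restricted_convex_smooth ::
    "nat \<Rightarrow> nat \<Rightarrow> real \<Rightarrow> (real^'p^'p \<Rightarrow> real) \<Rightarrow> bool" where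
  "restricted_convex_smooth k l \<delta> f \<longleftrightarrow>
     (\<forall>X G. rank X \<le> k \<longrightarrow> rank G \<le> l \<longrightarrow>
        (1 - \<delta>) * (norm G)\<^sup>2 \<le> hessian_form f X G G \<and>
        hessian_form f X G G \<le> (1 + \<delta>) * (norm G)\<^sup>2)"

text \<open>
  Points, functions and tangent vectors of the quotient of the full-column-rank matrices by the
  orthogonal group are expressed through representatives Y of the classes [Y] and through
  horizontal lifts at Y.
\<close>

definition quot_dist :: "real^'r^'p \<Rightarrow> real^'r^'p \<Rightarrow> real" where
  "quot_dist Y1 Y2 = (INF Q\<in>{Q. orthogonal_matrix Q}. norm (Y2 ** Q - Y1))"

definition horizontal :: "real^'r^'p \<Rightarrow> (real^'r^'p) set" where
  "horizontal Y = {\<theta>. transpose (transpose Y ** \<theta>) = transpose Y ** \<theta>}"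

definition h_obj :: "(real^'p^'p \<Rightarrow> real) \<Rightarrow> real^'r^'p \<Rightarrow> real" where
  "h_obj f Y = f (Y ** transpose Y)"

definition H_obj :: "real^'p^'p \<Rightarrow> real^'r^'p \<Rightarrow> real" where
  "H_obj Xs Y = (norm (Y ** transpose Y - Xs))\<^sup>2 / 2"

text \<open>
  The total space carries the flat metric, so the lifted Riemannian gradient at Y is the Euclidean
  gradient of the lifted function, and the lifted Riemannian Hessian is the restriction to
  horizontal Y of its Euclidean second derivative. The closed forms below are related to these by
  \<open>gradient_H_obj\<close> and \<open>hessian_form_h_obj\<close>; on the diagonal the Hessian is the
  familiar quadratic form \<open>lifted_hess_h_diag\<close>.
\<close>

definition lifted_grad_H :: "real^'p^'p \<Rightarrow> real^'r^'p \<Rightarrow> real^'r^'p" where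
  "lifted_grad_H Xs Y = 2 *\<^sub>R ((Y ** transpose Y - Xs) ** Y)"

definition lifted_hess_h ::
    "(real^'p^'p \<Rightarrow> real) \<Rightarrow> real^'r^'p \<Rightarrow> real^'r^'p \<Rightarrow> real^'r^'p \<Rightarrow> real" where
  "lifted_hess_h f Y \<theta> \<eta> =
     hessian_form f (Y ** transpose Y)
       (Y ** transpose \<theta> + \<theta> ** transpose Y) (Y ** transpose \<eta> + \<eta> ** transpose Y)
     + gradient f (Y ** transpose Y) \<bullet> (\<theta> ** transpose \<eta> + \<eta> ** transpose \<theta>)"

text \<open>
  Eigenvalues of the self-adjoint operator on horizontal Y that represents the Hessian form with
  respect to the Frobenius inner product.
\<close>

definition hess_h_eigenvalue :: "(real^'p^'p \<Rightarrow> real) \<Rightarrow> real^'r^'p \<Rightarrow> real \<Rightarrow> bool" where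
  "hess_h_eigenvalue f Y l \<longleftrightarrow>
     (\<exists>\<theta>\<in>horizontal Y. \<theta> \<noteq> 0 \<and> (\<forall>\<eta>\<in>horizontal Y. lifted_hess_h f Y \<theta> \<eta> = l * (\<theta> \<bullet> \<eta>)))"

definition escaping_direction :: "(real^'p^'p \<Rightarrow> real) \<Rightarrow> real^'r^'p \<Rightarrow> real^'r^'p \<Rightarrow> bool" where
  "escaping_direction f Y \<theta> \<longleftrightarrow> \<theta> \<in> horizontal Y \<and> lifted_hess_h f Y \<theta> \<theta> < 0"

definition cond_kappa :: "real^'r^'p \<Rightarrow> real" where
  "cond_kappa Ys = sing_val 1 Ys / sing_val CARD('r) Ys"

definition region2 ::
    "real^'p^'p \<Rightarrow> real^'r^'p \<Rightarrow> real \<Rightarrow> real \<Rightarrow> real \<Rightarrow> real \<Rightarrow> (real^'r^'p) set" where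
  "region2 Xs Ys \<mu> \<alpha> \<beta> \<gamma> = {Y \<in> full_col_rank.
     quot_dist Y Ys > \<mu> * sing_val CARD('r) Ys / cond_kappa Ys \<and>
     norm (lifted_grad_H Xs Y) \<le> \<alpha> * \<mu> * sing_val CARD('r) Ys ^ 3 / (4 * cond_kappa Ys) \<and>
     spectral_norm Y \<le> \<beta> * spectral_norm Ys \<and>
     norm (Y ** transpose Y) \<le> \<gamma> * norm (Ys ** transpose Ys)}"


lemma h_obj_orbit:
  assumes "orthogonal_matrix Q"
  shows "h_obj f (Y ** Q) = h_obj f Y" and "H_obj Xs (Y ** Q) = H_obj Xs Y"
proof -
  have "Y ** Q ** transpose (Y ** Q) = Y ** (Q ** transpose Q) ** transpose Y"
    by (simp add: matrix_transpose_mul matrix_mul_assoc)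
  also have "\<dots> = Y ** transpose Y"
    using assms by (simp add: orthogonal_matrix_def)
  finally show "h_obj f (Y ** Q) = h_obj f Y" and "H_obj Xs (Y ** Q) = H_obj Xs Y"
    by (simp_all add: h_obj_def H_obj_def)
qed

lemma gderiv_unique:
  fixes f :: "'a::euclidean_space \<Rightarrow> real"
  assumes "GDERIV f x :> D" and "GDERIV f x :> E"
  shows "D = E"
proof -
  have "(\<lambda>h. h \<bullet> D) = (\<lambda>h. h \<bullet> E)"
    using assms has_derivative_unique unfolding gderiv_def by blast
  then show ?thesis by (metis inner_commute vector_eq_rdot)
qed

lemma gradientI:
  fixes f :: "'a::euclidean_space \<Rightarrow> real"
  shows "GDERIV f x :> D \<Longrightarrow> gradient f x = D"
  unfolding gradient_def using gderiv_unique by blast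

lemma gderiv_gradient:
  fixes f :: "'a::euclidean_space \<Rightarrow> real"
  assumes "f differentiable (at x)"
  shows "GDERIV f x :> gradient f x"
proof -
  obtain f' where f': "(f has_derivative f') (at x)"
    using assms by (auto simp: differentiable_def)
  interpret linear f' using f' has_derivative_linear by blast
  have "f' h = h \<bullet> (\<Sum>b\<in>Basis. f' b *\<^sub>R b)" for h
  proof -
    have "f' h = f' (\<Sum>b\<in>Basis. (h \<bullet> b) *\<^sub>R b)" by (simp add: euclidean_representation)
    also have "\<dots> = (\<Sum>b\<in>Basis. (h \<bullet> b) * f' b)" by (simp add: sum scale)
    also have "\<dots> = h \<bullet> (\<Sum>b\<in>Basis. f' b *\<^sub>R b)"
      by (simp add: inner_sum_right inner_scaleR_right mult.commute)
    finally show ?thesis .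
  qed
  then have "f' = (\<lambda>h. h \<bullet> (\<Sum>b\<in>Basis. f' b *\<^sub>R b))" by (rule ext)
  then have "GDERIV f x :> (\<Sum>b\<in>Basis. f' b *\<^sub>R b)"
    unfolding gderiv_def using f' by (rule subst[where P = "\<lambda>g. (f has_derivative g) (at x)"])
  then show ?thesis by (simp only: gradientI)
qed

lemma bounded_bilinear_matrix_mult:
  "bounded_bilinear ((**) :: real^'n^'m \<Rightarrow> real^'k^'n \<Rightarrow> real^'k^'m)"
  unfolding bilinear_conv_bounded_bilinear[symmetric] bilinear_def
  by (auto intro!: linearI
      simp: matrix_matrix_mult_def vec_eq_iff sum.distrib sum_distrib_left algebra_simps)

lemma bounded_linear_transpose: "bounded_linear (transpose :: real^'n^'m \<Rightarrow> real^'m^'n)"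
  unfolding linear_conv_bounded_linear[symmetric]
  by (auto intro!: linearI simp: transpose_def vec_eq_iff)

lemma inner_transpose:
  fixes A B :: "real^'n^'m"
  shows "transpose A \<bullet> transpose B = A \<bullet> B"
  unfolding inner_vec_def transpose_def by simp (rule sum.swap)

lemma inner_mult_left:
  fixes A :: "real^'n^'m" and B :: "real^'k^'n"
  shows "(A ** B) \<bullet> C = B \<bullet> (transpose A ** C)"
  by (simp add: inner_matrix_trace matrix_transpose_mul matrix_mul_assoc)

lemma inner_mult_right:
  fixes A :: "real^'n^'m" and B :: "real^'k^'n"
  shows "(A ** B) \<bullet> C = A \<bullet> (C ** transpose B)"
proof -
  have "(A ** B) \<bullet> C = (transpose B ** transpose A) \<bullet> transpose C"
    by (simp only: matrix_transpose_mul[symmetric] inner_transpose)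
  also have "\<dots> = transpose A \<bullet> transpose (C ** transpose B)"
    by (simp only: inner_mult_left matrix_transpose_mul transpose_transpose)
  finally show ?thesis by (simp only: inner_transpose)
qed

lemma has_derivative_outer:
  fixes Y :: "real^'r^'p"
  shows "((\<lambda>Y. Y ** transpose Y) has_derivative
           (\<lambda>\<eta>. Y ** transpose \<eta> + \<eta> ** transpose Y)) (at Y)"
  by (intro bounded_bilinear.FDERIV[OF bounded_bilinear_matrix_mult]
      bounded_linear_imp_has_derivative bounded_linear_transpose has_derivative_ident)

lemma inner_outer:
  fixes Y \<eta> :: "real^'r^'p"
  shows "(Y ** transpose \<eta> + \<eta> ** transpose Y) \<bullet> G = \<eta> \<bullet> ((G + transpose G) ** Y)"
proof -
  have "(Y ** transpose \<eta>) \<bullet> G = (\<eta> ** transpose Y) \<bullet> transpose G"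
    by (metis inner_transpose matrix_transpose_mul transpose_transpose)
  then show ?thesis
    by (simp add: inner_add_left inner_mult_right[of \<eta>] bounded_bilinear.add_left[OF bounded_bilinear_matrix_mult] inner_add_right)
qed

lemma gderiv_comp_outer:
  fixes f :: "real^'p^'p \<Rightarrow> real" and Y :: "real^'r^'p"
  assumes "GDERIV f (Y ** transpose Y) :> G"
  shows "GDERIV (\<lambda>Y. f (Y ** transpose Y)) Y :> (G + transpose G) ** Y"
  using has_derivative_compose[OF has_derivative_outer assms[unfolded gderiv_def]]
  by (simp add: gderiv_def inner_outer)

lemma gradient_H_obj:
  fixes Y :: "real^'r^'p"
  assumes "transpose Xs = Xs"
  shows "gradient (H_obj Xs) Y = lifted_grad_H Xs Y"
proof -
  have "GDERIV (\<lambda>Z. (norm (Z - Xs))\<^sup>2 / 2) X :> X - Xs" for X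
    unfolding gderiv_def power2_norm_eq_inner
    by (auto intro!: derivative_eq_intros simp: inner_commute)
  then have "GDERIV (H_obj Xs) Y :>
      (Y ** transpose Y - Xs + transpose (Y ** transpose Y - Xs)) ** Y"
    unfolding H_obj_def by (rule gderiv_comp_outer)
  moreover have "transpose (Y ** transpose Y - Xs) = Y ** transpose Y - Xs"
    using assms linear_diff[OF bounded_linear.linear[OF bounded_linear_transpose]]
    by (metis matrix_transpose_mul transpose_transpose)
  ultimately have "GDERIV (H_obj Xs) Y :>
      (Y ** transpose Y - Xs + (Y ** transpose Y - Xs)) ** Y"
    by (simp only:)
  then have "gradient (H_obj Xs) Y = (Y ** transpose Y - Xs + (Y ** transpose Y - Xs)) ** Y"
    by (rule gradientI)
  then show ?thesis
    unfolding lifted_grad_H_def bounded_bilinear.add_left[OF bounded_bilinear_matrix_mult] scaleR_2 .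
qed

lemma hessian_form_h_obj:
  fixes Y :: "real^'r^'p" and f :: "real^'p^'p \<Rightarrow> real"
  assumes "twice_cont_diff f"
  shows "hessian_form (h_obj f) Y \<theta> \<eta> = lifted_hess_h f Y \<theta> \<eta>"
proof -
  obtain f'' where df: "\<And>x. f differentiable (at x)"
    and f'': "\<And>x. (gradient f has_derivative blinfun_apply (f'' x)) (at x)"
    using assms unfolding twice_cont_diff_def by blast
  let ?X = "Y ** transpose Y"
  let ?D = "\<lambda>\<theta>. blinfun_apply (f'' ?X) (Y ** transpose \<theta> + \<theta> ** transpose Y)"
  let ?g = "gradient f ?X"
  have "gradient (h_obj f) =
      (\<lambda>Y :: real^'r^'p. (gradient f (Y ** transpose Y) + transpose (gradient f (Y ** transpose Y))) ** Y)"
    unfolding h_obj_def using gradientI[OF gderiv_comp_outer[OF gderiv_gradient[OF df]]] by blast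
  moreover have D: "((\<lambda>Y. gradient f (Y ** transpose Y)) has_derivative ?D) (at Y)"
    by (rule has_derivative_compose[OF has_derivative_outer f''])
  ultimately have "(gradient (h_obj f) has_derivative
      (\<lambda>\<theta>. (?g + transpose ?g) ** \<theta> + (?D \<theta> + transpose (?D \<theta>)) ** Y)) (at Y)"
    by (simp only:) (intro bounded_bilinear.FDERIV[OF bounded_bilinear_matrix_mult] has_derivative_add
        bounded_linear.has_derivative[OF bounded_linear_transpose] has_derivative_ident)
  then have "hessian_form (h_obj f) Y \<theta> \<eta> =
      \<eta> \<bullet> ((?g + transpose ?g) ** \<theta>) + \<eta> \<bullet> ((?D \<theta> + transpose (?D \<theta>)) ** Y)"
    unfolding hessian_form_def
    by (simp add: frechet_derivative_at[symmetric] inner_add_right inner_commute)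
  also have "\<dots> = lifted_hess_h f Y \<theta> \<eta>"
    unfolding inner_outer[symmetric] lifted_hess_h_def hessian_form_def
      frechet_derivative_at[OF f'', symmetric]
    by (simp add: inner_commute)
  finally show ?thesis .
qed

lemma lifted_hess_h_diag:
  "lifted_hess_h f Y \<theta> \<theta> =
     hessian_form f (Y ** transpose Y)
       (Y ** transpose \<theta> + \<theta> ** transpose Y) (Y ** transpose \<theta> + \<theta> ** transpose Y)
     + 2 * (gradient f (Y ** transpose Y) \<bullet> (\<theta> ** transpose \<theta>))"
  unfolding lifted_hess_h_def inner_add_right by (simp only: mult_2)

end

theory Submission
  imports Defs
begin

text \<open>
  Put \<open>Z = Ys ** Q\<close>, \<open>\<theta> = Y - Z\<close>, \<open>W = \<theta> \<theta>\<^sup>T\<close> and \<open>\<Delta> = Y Y\<^sup>T - Z Z\<^sup>T\<close>, so that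
  \<open>M = Y \<theta>\<^sup>T + \<theta> Y\<^sup>T = \<Delta> + W\<close> and \<open>M \<bullet> \<Delta>\<close> is the inner product of \<open>\<theta>\<close> with the gradient of
  \<open>H\<close>. The Hessian form of \<open>H\<close> therefore equals
  \<open>W \<bullet> W - 3 (\<Delta> \<bullet> \<Delta>) + 4 (\<theta> \<bullet> grad H)\<close>. Optimality of \<open>Q\<close> makes \<open>Z\<^sup>T Y\<close> symmetric positive
  semidefinite, and completing squares then gives \<open>W \<bullet> W \<le> 2 (\<Delta> \<bullet> \<Delta>)\<close> and
  \<open>2 (sqrt 2 - 1) |Z \<theta>\<^sup>T|\<^sup>2 \<le> \<Delta> \<bullet> \<Delta>\<close>, which bounds the Hessian form of \<open>H\<close>.
  To pass to \<open>f\<close>, the mean value theorem writes \<open>\<nabla>f(Y Y\<^sup>T) \<bullet> W\<close> as \<open>\<nabla>f(Xs) \<bullet> W\<close> plus a value of the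
  Hessian form at \<open>\<Delta>, W\<close>; by polarization this value differs from \<open>\<Delta> \<bullet> W\<close> by at most
  \<open>\<delta> |\<Delta>| |W|\<close>.
\<close>

subsection \<open>Matrix algebra\<close>

lemmas matrix_mult_linear =
  bounded_bilinear.zero_left[OF bounded_bilinear_matrix_mult]
  bounded_bilinear.zero_right[OF bounded_bilinear_matrix_mult]
  bounded_bilinear.add_left[OF bounded_bilinear_matrix_mult]
  bounded_bilinear.add_right[OF bounded_bilinear_matrix_mult]
  bounded_bilinear.diff_left[OF bounded_bilinear_matrix_mult]
  bounded_bilinear.diff_right[OF bounded_bilinear_matrix_mult]
  bounded_bilinear.minus_left[OF bounded_bilinear_matrix_mult]
  bounded_bilinear.minus_right[OF bounded_bilinear_matrix_mult]
  bounded_bilinear.scaleR_left[OF bounded_bilinear_matrix_mult]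
  bounded_bilinear.scaleR_right[OF bounded_bilinear_matrix_mult]

lemmas transpose_linear =
  linear_0[OF bounded_linear.linear[OF bounded_linear_transpose]]
  linear_add[OF bounded_linear.linear[OF bounded_linear_transpose]]
  linear_diff[OF bounded_linear.linear[OF bounded_linear_transpose]]
  transpose_scalar matrix_transpose_mul

text \<open>Trades inner products of large outer-type matrices for inner products of small Gram-type
  matrices, on which the computation in \<open>procrustes_gap\<close> runs.\<close>

lemma inner_mult_transpose_mult_transpose:
  fixes A C :: "real^'k^'m" and B E :: "real^'k^'n"
  shows "(A ** transpose B) \<bullet> (C ** transpose E) = (transpose A ** C) \<bullet> (transpose B ** E)"
proof -
  have "(A ** transpose B) \<bullet> (C ** transpose E) = transpose B \<bullet> ((transpose A ** C) ** transpose E)"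
    by (simp add: inner_mult_left matrix_mul_assoc)
  also have "\<dots> = (transpose A ** C) \<bullet> (transpose B ** E)"
    by (subst inner_commute) (simp add: inner_mult_right)
  finally show ?thesis .
qed

lemma norm_orthogonal_mult_right:
  fixes A :: "real^'n^'m"
  assumes "orthogonal_matrix Q"
  shows "norm (A ** Q) = norm A"
proof -
  have "(A ** Q) \<bullet> (A ** Q) = A \<bullet> (A ** (Q ** transpose Q))"
    by (simp add: inner_mult_right matrix_mul_assoc)
  then show ?thesis
    using assms by (simp add: orthogonal_matrix_def norm_eq_sqrt_inner)
qed

lemma norm_transpose: "norm (transpose A) = norm (A :: real^'n^'m)"
  by (simp add: norm_eq_sqrt_inner inner_transpose)

subsection \<open>The orthogonal Procrustes problem\<close>

definition outer_prod :: "real^'m \<Rightarrow> real^'n \<Rightarrow> real^'n^'m" where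
  "outer_prod u v = (\<chi> i j. u $ i * v $ j)"

lemma outer_prod_mult: "outer_prod a b ** outer_prod c d = (b \<bullet> c) *\<^sub>R outer_prod a d"
  by (simp add: outer_prod_def matrix_matrix_mult_def vec_eq_iff inner_vec_def sum_distrib_left
      sum_distrib_right algebra_simps)

lemma transpose_outer_prod: "transpose (outer_prod a b) = outer_prod b a"
  by (simp add: outer_prod_def transpose_def vec_eq_iff mult.commute)

lemma inner_outer_prod: "outer_prod u v \<bullet> N = u \<bullet> (N *v v)"
  by (simp add: outer_prod_def inner_vec_def matrix_vector_mult_def sum_distrib_left algebra_simps)

text \<open>The reflection in the hyperplane orthogonal to \<open>v\<close>. For
  \<open>v = 0\<close> division by zero makes it the identity, so it is orthogonal for every
  \<open>v\<close>.\<close>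

definition householder :: "real^'n \<Rightarrow> real^'n^'n" where
  "householder v = mat 1 - (2 / (v \<bullet> v)) *\<^sub>R outer_prod v v"

lemma orthogonal_householder: "orthogonal_matrix (householder v)"
proof -
  let ?c = "2 / (v \<bullet> v)"
  \<comment> \<open>This identity cancels the two rank-one terms of the product; at
    \<open>v = 0\<close> both sides are 0.\<close>
  have c: "?c * (?c * (v \<bullet> v)) = 2 * ?c" by (cases "v = 0") (simp_all add: field_simps)
  have "transpose (householder v) ** householder v =
      mat 1 - (2 * ?c) *\<^sub>R outer_prod v v + (?c * (?c * (v \<bullet> v))) *\<^sub>R outer_prod v v"
    unfolding scaleR_2[of "?c *\<^sub>R outer_prod v v", unfolded scaleR_scaleR]
    by (simp add: householder_def transpose_linear transpose_outer_prod matrix_mult_linear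
        outer_prod_mult algebra_simps del: times_divide_eq_left times_divide_eq_right)
  then show ?thesis
    unfolding orthogonal_matrix c by simp
qed

text \<open>A first-order optimality condition without derivatives: for small \<open>t\<close> of
  the sign of \<open>d\<close> the linear term would dominate. It serves for matrix symmetry, for
  best approximations and for eigenvectors.\<close>

lemma linear_le_quadratic_imp_zero:
  fixes d K :: real
  assumes "\<And>t. t * d \<le> t\<^sup>2 * K"
  shows "d = 0"
proof (rule ccontr)
  assume d: "d \<noteq> 0"
  \<comment> \<open>Any positive number above \<open>K\<close> works: \<open>t = d / m\<close> would
    force \<open>m \<le> K\<close>.\<close>
  define m where "m = \<bar>K\<bar> + 1"
  have m: "0 < m" "K < m" by (auto simp: m_def)
  have "d / m * d \<le> (d / m)\<^sup>2 * K" by (rule assms)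
  then have "d\<^sup>2 * m \<le> d\<^sup>2 * K"
    using m by (simp add: field_simps power2_eq_square)
  then show False using d m by simp
qed

text \<open>Testing the optimality of the identity against one Householder reflection gives
  semidefiniteness, against products of two almost equal reflections gives symmetry.\<close>

lemma trace_maximal_imp_sym_psd:
  fixes N :: "real^'n^'n"
  assumes max: "\<And>R. orthogonal_matrix R \<Longrightarrow> R \<bullet> N \<le> mat 1 \<bullet> N"
  shows "sym_psd N"
proof -
  have psd: "0 \<le> v \<bullet> (N *v v)" for v
  proof -
    have "0 \<le> 2 / (v \<bullet> v) * (v \<bullet> (N *v v))"
      using max[OF orthogonal_householder[of v]]
      by (simp add: householder_def inner_diff_left inner_outer_prod)
    moreover have "0 < 2 / (v \<bullet> v)" if "v \<noteq> 0" using that by simp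
    ultimately show ?thesis
      by (cases "v = 0") (simp, metis zero_le_mult_iff not_le)
  qed
  have "N $ j $ i = N $ i $ j" for i j
  proof (cases "i = j")
    case False
    define u w :: "real^'n" where "u = axis i 1" and "w = axis j 1"
    have uw: "u \<bullet> u = 1" "w \<bullet> w = 1" "u \<bullet> w = 0"
      using False by (simp_all add: u_def w_def inner_axis_axis)
    have comp: "N $ k $ l = axis k 1 \<bullet> (N *v axis l 1)" for k l
      by (simp add: inner_axis' matrix_vector_mult_basis column_def)
    have "t * (u \<bullet> (N *v w) - w \<bullet> (N *v u)) \<le> t\<^sup>2 * (u \<bullet> (N *v u) + w \<bullet> (N *v w))" for t
    proof -
      \<comment> \<open>The reflections along \<open>u\<close> and \<open>v\<close> compose to a
        rotation in the plane of \<open>u\<close> and \<open>w\<close>, which is the identity at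
        \<open>t = 0\<close>.\<close>
      define v where "v = u + t *\<^sub>R w"
      define q where "q = 1 + t\<^sup>2"
      have vv: "v \<bullet> v = q" and uv: "u \<bullet> v = 1"
        using uw by (simp_all add: v_def q_def inner_add_left inner_add_right inner_commute power2_eq_square)
      have pos: "q > 0" unfolding q_def by (smt (verit) zero_le_power2)
      have "householder u ** householder v = mat 1 - 2 *\<^sub>R outer_prod u u
          - (2 / q) *\<^sub>R outer_prod v v + (4 / q) *\<^sub>R outer_prod u v"
        by (simp add: householder_def uw vv uv matrix_mult_linear outer_prod_mult algebra_simps)
      then have "(mat 1 - 2 *\<^sub>R outer_prod u u - (2 / q) *\<^sub>R outer_prod v v
          + (4 / q) *\<^sub>R outer_prod u v) \<bullet> N \<le> mat 1 \<bullet> N"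
        using max[OF orthogonal_matrix_mul[OF orthogonal_householder orthogonal_householder], of u v]
        by simp
      then have "- 2 * (u \<bullet> (N *v u)) - 2 / q * (v \<bullet> (N *v v))
          + 4 / q * (u \<bullet> (N *v v)) \<le> 0"
        by (simp add: inner_diff_left inner_add_left inner_outer_prod)
      \<comment> \<open>The previous inequality times \<open>q / 2\<close>. Expanding
        \<open>v\<close>, the terms of order 0 in \<open>t\<close> cancel and the linear one is the
        antisymmetric part of \<open>N\<close>.\<close>
      then have "- q * (u \<bullet> (N *v u)) - v \<bullet> (N *v v) + 2 * (u \<bullet> (N *v v)) \<le> 0"
        using pos by (simp add: field_simps)
      then show ?thesis
        by (simp add: v_def q_def matrix_vector_right_distrib matrix_vector_mult_scaleR inner_add_left
            inner_add_right algebra_simps power2_eq_square)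
    qed
    then show ?thesis
      using linear_le_quadratic_imp_zero unfolding u_def w_def comp by (metis right_minus_eq)
  qed simp
  then have "transpose N = N" by (simp add: transpose_def vec_eq_iff)
  with psd show ?thesis by (simp add: sym_psd_def)
qed

text \<open>Orthogonal factors do not change \<open>norm A\<close>, so minimizing the distance means
  maximizing \<open>S \<bullet> (transpose A ** B)\<close>. Comparing \<open>Q\<close> with
  \<open>Q ** R\<close> makes the identity the maximizer for
  \<open>transpose (A ** Q) ** B\<close>.\<close>

lemma procrustes_sym_psd:
  fixes A B :: "real^'n^'m"
  assumes opt: "is_arg_min (\<lambda>R. norm (A ** R - B)) orthogonal_matrix Q"
  shows "sym_psd (transpose (A ** Q) ** B)"
proof (rule trace_maximal_imp_sym_psd)
  fix R :: "real^'n^'n"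
  assume R: "orthogonal_matrix R"
  have Q: "orthogonal_matrix Q" using opt by (simp add: is_arg_min_def)
  have expand: "(norm (A ** S - B))\<^sup>2 = (norm A)\<^sup>2 + (norm B)\<^sup>2 - 2 * (S \<bullet> (transpose A ** B))"
    if "orthogonal_matrix S" for S
  proof -
    have "(norm (A ** S - B))\<^sup>2 = (norm (A ** S))\<^sup>2 + (norm B)\<^sup>2 - 2 * ((A ** S) \<bullet> B)"
      by (simp add: power2_norm_eq_inner inner_diff_left inner_diff_right inner_commute)
    then show ?thesis
      by (simp only: norm_orthogonal_mult_right[OF that] inner_mult_left)
  qed
  have "norm (A ** Q - B) \<le> norm (A ** (Q ** R) - B)"
    using opt orthogonal_matrix_mul[OF Q R] by (auto simp: is_arg_min_linorder)
  then have "(norm (A ** Q - B))\<^sup>2 \<le> (norm (A ** (Q ** R) - B))\<^sup>2"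
    by (simp add: power_mono)
  then have "(Q ** R) \<bullet> (transpose A ** B) \<le> (Q ** mat 1) \<bullet> (transpose A ** B)"
    by (simp add: expand Q orthogonal_matrix_mul R)
  then show "R \<bullet> (transpose (A ** Q) ** B) \<le> mat 1 \<bullet> (transpose (A ** Q) ** B)"
    unfolding inner_mult_left by (simp only: matrix_transpose_mul matrix_mul_assoc)
qed

text \<open>The inner product is the sum of the quadratic form of \<open>N\<close> over the rows of
  \<open>\<theta>\<close>.\<close>

lemma inner_sym_psd_gram_nonneg:
  fixes N :: "real^'r^'r" and \<theta> :: "real^'r^'p"
  assumes "sym_psd N"
  shows "0 \<le> N \<bullet> (transpose \<theta> ** \<theta>)"
proof -
  have "N \<bullet> (transpose \<theta> ** \<theta>) = \<theta> \<bullet> (\<theta> ** transpose N)"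
    by (metis inner_commute inner_mult_left inner_mult_right transpose_transpose)
  also have "\<dots> = (\<Sum>i\<in>UNIV. (\<theta> $ i) \<bullet> (N *v (\<theta> $ i)))"
    unfolding inner_vec_def[of \<theta>]
    by (intro sum.cong refl arg_cong2[where f = "(\<bullet>)"])
      (simp add: matrix_matrix_mult_def matrix_vector_mult_def transpose_def vec_eq_iff mult.commute)
  also have "\<dots> \<ge> 0" using assms by (intro sum_nonneg) (simp add: sym_psd_def)
  finally show ?thesis .
qed

text \<open>In terms of \<open>P\<close>, \<open>K\<close> and \<open>D\<close> below, each
  inequality says that a square plus a nonnegative multiple of
  \<open>P \<bullet> D + K \<bullet> D\<close> is nonnegative. The latter sum is nonnegative because
  \<open>P + K = transpose Z ** Y\<close>.\<close>

lemma procrustes_gap: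
  fixes Y Z :: "real^'r^'p"
  assumes psd: "sym_psd (transpose Z ** Y)"
  defines "\<theta> \<equiv> Y - Z" and "\<Delta> \<equiv> Y ** transpose Y - Z ** transpose Z"
  shows "2 * (sqrt 2 - 1) * (norm (Z ** transpose \<theta>))\<^sup>2 \<le> (norm \<Delta>)\<^sup>2"
    and "(norm (\<theta> ** transpose \<theta>))\<^sup>2 \<le> 2 * (norm \<Delta>)\<^sup>2"
proof -
  define P where "P = transpose Z ** \<theta>"
  define K where "K = transpose Z ** Z"
  define D where "D = transpose \<theta> ** \<theta>"
  have N: "transpose Z ** Y = P + K"
    by (simp add: P_def K_def \<theta>_def matrix_mult_linear)
  have symK: "transpose K = K"
    by (simp add: K_def transpose_linear)
  \<comment> \<open>Symmetry passes from \<open>P + K\<close> to \<open>P\<close>, so that the mixed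
    term of \<open>Z ** transpose \<theta>\<close> and its transpose becomes
    \<open>P \<bullet> P\<close>.\<close>
  have symP: "transpose \<theta> ** Z = P"
  proof -
    have "transpose (P + K) = P + K" using psd by (simp add: N sym_psd_def)
    then have "transpose P = P" by (simp add: transpose_linear symK)
    then show ?thesis by (simp add: P_def matrix_transpose_mul)
  qed
  have "\<Delta> = Z ** transpose \<theta> + \<theta> ** transpose Z + \<theta> ** transpose \<theta>"
    by (simp add: \<Delta>_def \<theta>_def transpose_linear matrix_mult_linear)
  then have norm\<Delta>: "(norm \<Delta>)\<^sup>2 = 2 * (K \<bullet> D) + 2 * (P \<bullet> P) + 4 * (P \<bullet> D) + D \<bullet> D"
    by (simp add: power2_norm_eq_inner inner_add_left inner_add_right
        inner_mult_transpose_mult_transpose symP inner_commute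
        flip: P_def K_def D_def)
  have normW: "(norm (\<theta> ** transpose \<theta>))\<^sup>2 = D \<bullet> D"
    and normZ: "(norm (Z ** transpose \<theta>))\<^sup>2 = K \<bullet> D"
    by (simp_all add: power2_norm_eq_inner inner_mult_transpose_mult_transpose flip: K_def D_def)
  have ND: "0 \<le> P \<bullet> D + K \<bullet> D"
    using inner_sym_psd_gram_nonneg[OF psd, of \<theta>] by (simp add: N inner_add_left flip: D_def)
  have s2: "sqrt 2 \<le> 2" by (rule real_le_lsqrt) auto
  \<comment> \<open>The factor \<open>sqrt 2\<close> matches the term
    \<open>2 * (P \<bullet> P)\<close>. What remains of \<open>4 * (P \<bullet> D)\<close> has
    coefficient \<open>4 - 2 * sqrt 2\<close>, and the constant \<open>2 * (sqrt 2 - 1)\<close>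
    leaves exactly the same coefficient on \<open>K \<bullet> D\<close>.\<close>
  have "0 \<le> (D + sqrt 2 *\<^sub>R P) \<bullet> (D + sqrt 2 *\<^sub>R P)" by simp
  then have "0 \<le> D \<bullet> D + 2 * sqrt 2 * (P \<bullet> D) + 2 * (P \<bullet> P)"
    by (simp add: inner_add_left inner_add_right inner_commute algebra_simps)
  moreover have "0 \<le> (4 - 2 * sqrt 2) * (P \<bullet> D + K \<bullet> D)"
    using ND s2 by (intro mult_nonneg_nonneg) auto
  ultimately show "2 * (sqrt 2 - 1) * (norm (Z ** transpose \<theta>))\<^sup>2 \<le> (norm \<Delta>)\<^sup>2"
    unfolding norm\<Delta> normZ by (simp add: algebra_simps)
  have "0 \<le> (D + 2 *\<^sub>R P) \<bullet> (D + 2 *\<^sub>R P)" by simp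
  then have "0 \<le> D \<bullet> D + 4 * (P \<bullet> D) + 4 * (P \<bullet> P)"
    by (simp add: inner_add_left inner_add_right inner_commute)
  with ND show "(norm (\<theta> ** transpose \<theta>))\<^sup>2 \<le> 2 * (norm \<Delta>)\<^sup>2"
    unfolding norm\<Delta> normW by simp
qed

lemma horizontal_procrustes:
  fixes Y Z :: "real^'r^'p"
  assumes "transpose (transpose Z ** Y) = transpose Z ** Y"
  shows "Y - Z \<in> horizontal Y"
  using assms by (simp add: horizontal_def transpose_linear matrix_mult_linear)

subsection \<open>Rank and best low-rank approximation\<close>

lemma rank_add_le:
  fixes A B :: "real^'n^'m"
  shows "rank (A + B) \<le> rank A + rank B"
proof -
  let ?S = "range ((*v) A)" and ?T = "range ((*v) B)"
  have sub: "subspace ?S" "subspace ?T" by (auto intro: subspace_UNIV linear_subspace_image)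
  have "rank (A + B) \<le> dim {x + y |x y. x \<in> ?S \<and> y \<in> ?T}"
    unfolding rank_dim_range by (rule dim_subset) (auto simp: matrix_vector_mult_add_rdistrib)
  also have "\<dots> \<le> dim ?S + dim ?T"
    using dim_sums_Int[OF sub] by linarith
  finally show ?thesis by (simp add: rank_dim_range)
qed

lemma rank_scaleR_le:
  fixes A :: "real^'n^'m"
  shows "rank (c *\<^sub>R A) \<le> rank A"
proof -
  have "c *\<^sub>R A = A ** (c *\<^sub>R mat 1)" by (simp add: matrix_mult_linear)
  then show ?thesis by (metis rank_mul_le_left)
qed

lemma rank_mult_le_inner:
  fixes A :: "real^'r^'p" and B :: "real^'q^'r"
  shows "rank (A ** B) \<le> CARD('r)"
  using rank_mul_le_left[of A B] rank_bound[of A] by simp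

text \<open>Scaling preserves the rank bound. Optimality of \<open>G\<close> along its own line
  gives \<open>A \<bullet> G = G \<bullet> G\<close>, and comparison with the projection of
  \<open>A\<close> to the line of \<open>B\<close> then bounds that projection by
  \<open>norm G\<close>.\<close>

lemma inner_le_best_rank_approx:
  fixes A B G :: "real^'n^'m"
  assumes best: "best_rank_approx k A G" and rk: "rank B \<le> k"
  shows "A \<bullet> B \<le> norm G * norm B"
proof (cases "B = 0")
  case False
  have G: "rank G \<le> k" and opt: "norm (A - G) \<le> norm (A - C)" if "rank C \<le> k" for C
    using best that by (auto simp: best_rank_approx_def is_arg_min_linorder)
  have sq: "(norm (A - C))\<^sup>2 = A \<bullet> A - 2 * (A \<bullet> C) + C \<bullet> C" for C
    by (simp add: power2_norm_eq_inner inner_diff_left inner_diff_right inner_commute)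
  have ineq: "- 2 * (A \<bullet> G) + G \<bullet> G \<le> - 2 * (A \<bullet> C) + C \<bullet> C" if "rank C \<le> k" for C
    using power_mono[OF opt[OF that] norm_ge_zero, of 2] by (simp add: sq)
  have "A \<bullet> G = G \<bullet> G"
  proof -
    \<comment> \<open>The competitor is \<open>(1 + t) *\<^sub>R G\<close>.\<close>
    have "t * (2 * (A \<bullet> G - G \<bullet> G)) \<le> t\<^sup>2 * (G \<bullet> G)" for t
      using ineq[OF order_trans[OF rank_scaleR_le G[OF rk]], of "1 + t"]
      by (simp add: algebra_simps power2_eq_square)
    then have "2 * (A \<bullet> G - G \<bullet> G) = 0"
      by (rule linear_le_quadratic_imp_zero)
    then show ?thesis by simp
  qed
  moreover have "- 2 * (A \<bullet> G) + G \<bullet> G \<le> - ((A \<bullet> B)\<^sup>2 / (B \<bullet> B))"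
    using ineq[OF order_trans[OF rank_scaleR_le rk], of "(A \<bullet> B) / (B \<bullet> B)"] False
    by (simp add: field_simps power2_eq_square)
  ultimately have "(A \<bullet> B)\<^sup>2 \<le> (norm G * norm B)\<^sup>2"
    using False by (simp add: field_simps power_mult_distrib power2_norm_eq_inner)
  then show ?thesis
    by (rule power2_le_imp_le) simp
qed simp

subsection \<open>The Hessian form\<close>

lemma hessian_form_eq:
  assumes "(gradient f has_derivative D) (at x)"
  shows "hessian_form f x u v = D u \<bullet> v"
  by (simp add: hessian_form_def frechet_derivative_at[OF assms, symmetric])

text \<open>Pairing the gradient with a fixed \<open>w\<close> gives a real function on the segment,
  to which the scalar mean value theorem applies.\<close>

lemma gradient_mvt:
  fixes f :: "'a::euclidean_space \<Rightarrow> real"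
  assumes "twice_cont_diff f"
  shows "\<exists>t\<in>{0<..<1}. (gradient f (x + v) - gradient f x) \<bullet> w = hessian_form f (x + t *\<^sub>R v) v w"
proof -
  obtain f'' where f'': "\<And>x. (gradient f has_derivative blinfun_apply (f'' x)) (at x)"
    using assms unfolding twice_cont_diff_def by blast
  let ?g = "\<lambda>t. gradient f (x + t *\<^sub>R v) \<bullet> w"
  have line: "((\<lambda>t. x + t *\<^sub>R v) has_derivative (\<lambda>h. h *\<^sub>R v)) F" for F :: "real filter"
    by (auto intro!: derivative_eq_intros)
  have "((\<lambda>t. gradient f (x + t *\<^sub>R v)) has_derivative (\<lambda>h. f'' (x + t *\<^sub>R v) (h *\<^sub>R v))) (at t within T)"
    for t T
    by (rule has_derivative_compose[OF line f''])
  then have "(?g has_derivative (\<lambda>h. f'' (x + t *\<^sub>R v) (h *\<^sub>R v) \<bullet> w)) (at t within T)" for t T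
    by (rule has_derivative_inner_left)
  then have "\<exists>t\<in>{0<..<1}. ?g 1 - ?g 0 = f'' (x + t *\<^sub>R v) ((1 - 0) *\<^sub>R v) \<bullet> w"
    by (intro mvt_simple) auto
  then show ?thesis
    by (simp add: hessian_form_eq[OF f''] inner_diff_left)
qed

text \<open>Two mean value arguments: along \<open>u\<close> for the difference of two shifted
  copies of \<open>f\<close>, then along \<open>v\<close> for the gradient. The bound on
  \<open>y\<close> makes it converge to \<open>x\<close> as the increments shrink.\<close>

lemma mixed_difference_mvt:
  fixes f :: "'a::euclidean_space \<Rightarrow> real"
  assumes f: "twice_cont_diff f"
  shows "\<exists>y. norm (y - x) \<le> norm u + norm v \<and>
    f (x + u + v) - f (x + u) - f (x + v) + f x = hessian_form f y v u"
proof -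
  have GD: "(f has_derivative (\<lambda>h. h \<bullet> gradient f x)) (at x)" for x
    using gderiv_gradient f unfolding twice_cont_diff_def gderiv_def by blast
  let ?g = "\<lambda>t. f (x + v + t *\<^sub>R u) - f (x + t *\<^sub>R u)"
  have line: "((\<lambda>t. a + t *\<^sub>R u) has_derivative (\<lambda>h. h *\<^sub>R u)) F" for a :: 'a and F :: "real filter"
    by (auto intro!: derivative_eq_intros)
  have "((\<lambda>t. f (a + t *\<^sub>R u)) has_derivative (\<lambda>h. (h *\<^sub>R u) \<bullet> gradient f (a + t *\<^sub>R u))) (at t within T)"
    for t T a
    by (rule has_derivative_compose[OF line GD])
  then have "(?g has_derivative (\<lambda>h. (h *\<^sub>R u) \<bullet> gradient f (x + v + t *\<^sub>R u)
      - (h *\<^sub>R u) \<bullet> gradient f (x + t *\<^sub>R u))) (at t within T)" for t T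
    by (intro has_derivative_diff)
  then have "\<exists>t\<in>{0<..<1}. ?g 1 - ?g 0 = ((1 - 0) *\<^sub>R u) \<bullet> gradient f (x + v + t *\<^sub>R u)
      - ((1 - 0) *\<^sub>R u) \<bullet> gradient f (x + t *\<^sub>R u)"
    by (intro mvt_simple) auto
  then obtain t where t: "t \<in> {0<..<1}"
    and "?g 1 - ?g 0 = ((1 - 0) *\<^sub>R u) \<bullet> gradient f (x + v + t *\<^sub>R u)
      - ((1 - 0) *\<^sub>R u) \<bullet> gradient f (x + t *\<^sub>R u)"
    by blast
  then have eq: "?g 1 - ?g 0 = (gradient f (x + t *\<^sub>R u + v) - gradient f (x + t *\<^sub>R u)) \<bullet> u"
    by (simp add: inner_diff_right inner_commute[of _ u] add_ac)
  obtain t' where t': "t' \<in> {0<..<1}"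
    and eq': "(gradient f (x + t *\<^sub>R u + v) - gradient f (x + t *\<^sub>R u)) \<bullet> u
        = hessian_form f (x + t *\<^sub>R u + t' *\<^sub>R v) v u"
    using gradient_mvt[OF f] by blast
  have "norm (t *\<^sub>R u + t' *\<^sub>R v) \<le> norm (t *\<^sub>R u) + norm (t' *\<^sub>R v)" by (rule norm_triangle_ineq)
  also have "\<dots> \<le> norm u + norm v"
    using t t' by (intro add_mono) (auto simp: mult_left_le_one_le)
  finally have "norm (x + t *\<^sub>R u + t' *\<^sub>R v - x) \<le> norm u + norm v" by (simp add: add.assoc)
  moreover have "f (x + u + v) - f (x + u) - f (x + v) + f x = ?g 1 - ?g 0"
    by (simp add: add_ac)
  then have "f (x + u + v) - f (x + u) - f (x + v) + f x
      = hessian_form f (x + t *\<^sub>R u + t' *\<^sub>R v) v u"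
    by (simp only: eq eq')
  ultimately show ?thesis by blast
qed

text \<open>Schwarz: both mixed second derivatives are the limit of the same second difference
  quotient.\<close>

lemma hessian_form_sym:
  fixes f :: "'a::euclidean_space \<Rightarrow> real"
  assumes f: "twice_cont_diff f"
  shows "hessian_form f x u v = hessian_form f x v u"
proof -
  obtain f'' where f'': "\<And>x. (gradient f has_derivative blinfun_apply (f'' x)) (at x)"
    and cont: "continuous_on UNIV f''"
    using f unfolding twice_cont_diff_def by blast
  define t where "t n = 1 / real (Suc n)" for n
  have t: "t n > 0" "t \<longlonglongrightarrow> 0" for n
    using LIMSEQ_inverse_real_of_nat by (simp_all add: t_def[abs_def] inverse_eq_divide)
  define S where "S n = (f (x + t n *\<^sub>R u + t n *\<^sub>R v) - f (x + t n *\<^sub>R u) - f (x + t n *\<^sub>R v) + f x) / (t n)\<^sup>2" for n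
  \<comment> \<open>Stated for arbitrary \<open>a\<close> and \<open>b\<close>: the second
    difference is unchanged when \<open>u\<close> and \<open>v\<close> are exchanged, so the same
    sequence has both limits.\<close>
  have lim: "S' \<longlonglongrightarrow> hessian_form f x b a"
    if S': "\<And>n. S' n = (f (x + t n *\<^sub>R a + t n *\<^sub>R b) - f (x + t n *\<^sub>R a) - f (x + t n *\<^sub>R b) + f x) / (t n)\<^sup>2"
    for S' a b
  proof -
    have "\<exists>y. norm (y - x) \<le> t n * (norm a + norm b) \<and> S' n = hessian_form f y b a" for n
    proof -
      obtain y where "norm (y - x) \<le> norm (t n *\<^sub>R a) + norm (t n *\<^sub>R b)"
        and "S' n = hessian_form f y (t n *\<^sub>R b) (t n *\<^sub>R a) / (t n)\<^sup>2"
        using mixed_difference_mvt[OF f, of x "t n *\<^sub>R a" "t n *\<^sub>R b"] S' by metis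
      then show ?thesis
        using t(1)[of n]
        by (intro exI[of _ y])
          (simp add: hessian_form_eq[OF f''] blinfun.scaleR_right algebra_simps power2_eq_square)
    qed
    then obtain y where y: "\<And>n. norm (y n - x) \<le> t n * (norm a + norm b)"
      and S'y: "\<And>n. S' n = hessian_form f (y n) b a"
      by metis
    have "(\<lambda>n. y n - x) \<longlonglongrightarrow> 0"
    proof (rule tendsto_0_le[of "\<lambda>n. t n * (norm a + norm b)" _ _ 1])
      show "(\<lambda>n. t n * (norm a + norm b)) \<longlonglongrightarrow> 0"
        using tendsto_mult_left_zero[OF t(2)] .
    qed (use y in \<open>auto intro!: always_eventually order_trans[OF _ abs_ge_self]\<close>)
    then have "y \<longlonglongrightarrow> x" by (rule LIM_zero_cancel)
    then have "(\<lambda>n. f'' (y n)) \<longlonglongrightarrow> f'' x"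
      using cont continuous_on_tendsto_compose[of UNIV f'' y x] by simp
    then have "(\<lambda>n. f'' (y n) b \<bullet> a) \<longlonglongrightarrow> f'' x b \<bullet> a"
      by (intro tendsto_intros)
    moreover have "S' = (\<lambda>n. f'' (y n) b \<bullet> a)"
      using S'y by (simp add: fun_eq_iff hessian_form_eq[OF f''])
    ultimately show ?thesis by (simp add: hessian_form_eq[OF f''])
  qed
  have "S \<longlonglongrightarrow> hessian_form f x v u" by (rule lim) (simp add: S_def)
  moreover have "S \<longlonglongrightarrow> hessian_form f x u v" by (rule lim) (simp add: S_def add_ac)
  ultimately show ?thesis using LIMSEQ_unique by blast
qed

lemma bilinear_hessian_form:
  assumes "twice_cont_diff f"
  shows "bilinear (hessian_form f x)"
proof -
  obtain f'' where f'': "\<And>x. (gradient f has_derivative blinfun_apply (f'' x)) (at x)"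
    using assms unfolding twice_cont_diff_def by blast
  show ?thesis
    unfolding bilinear_def hessian_form_eq[OF f'']
    by (auto intro!: linearI simp: blinfun.add_right blinfun.scaleR_right inner_add_left inner_add_right)
qed

lemma bilinear_lifted_hess_h:
  fixes Y :: "real^'r^'p"
  assumes "twice_cont_diff f"
  shows "bilinear (lifted_hess_h f Y)"
proof -
  interpret H: bounded_bilinear "hessian_form f (Y ** transpose Y)"
    using bilinear_hessian_form[OF assms] by (simp add: bilinear_conv_bounded_bilinear)
  show ?thesis
    unfolding bilinear_def lifted_hess_h_def
    by (auto intro!: linearI simp: transpose_linear matrix_mult_linear H.add_left H.add_right
        H.scaleR_left H.scaleR_right inner_add_right algebra_simps simp flip: scaleR_add_right)
qed

lemma lifted_hess_h_sym:
  fixes Y :: "real^'r^'p"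
  assumes "twice_cont_diff f"
  shows "lifted_hess_h f Y \<theta> \<eta> = lifted_hess_h f Y \<eta> \<theta>"
  using hessian_form_sym[OF assms] by (simp add: lifted_hess_h_def add.commute)

text \<open>Rayleigh quotient: \<open>B x x\<close> attains its minimum on the compact unit sphere
  of \<open>S\<close>, and a minimizer is an eigenvector for the minimal value. Testing with
  \<open>\<theta>\<close> shows that this value is negative.\<close>

lemma exists_negative_eigenvalue:
  fixes B :: "'a::euclidean_space \<Rightarrow> 'a \<Rightarrow> real"
  assumes bil: "bilinear B" and sym: "\<And>x y. B x y = B y x"
    and S: "subspace S" "\<theta> \<in> S" and neg: "B \<theta> \<theta> < 0"
  shows "\<exists>l<0. \<exists>x\<in>S. x \<noteq> 0 \<and> (\<forall>y\<in>S. B x y = l * (x \<bullet> y))"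
proof -
  interpret B: bounded_bilinear B using bil by (simp add: bilinear_conv_bounded_bilinear)
  have \<theta>: "\<theta> \<noteq> 0" using neg by (auto simp: B.zero_left)
  have unit: "(1 / norm z) *\<^sub>R z \<in> S \<inter> sphere 0 1" if "z \<in> S" "z \<noteq> 0" for z
    using that S(1) by (simp add: subspace_scale)
  have "compact (S \<inter> sphere 0 1)"
    by (intro closed_Int_compact closed_subspace S compact_sphere)
  moreover have "S \<inter> sphere 0 1 \<noteq> {}" using unit[OF S(2) \<theta>] by blast
  moreover have "continuous_on (S \<inter> sphere 0 1) (\<lambda>x. B x x)"
    by (intro B.continuous_on continuous_on_id)
  ultimately obtain x where "x \<in> S \<inter> sphere 0 1"
    and min: "\<And>z. z \<in> S \<inter> sphere 0 1 \<Longrightarrow> B x x \<le> B z z"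
    using continuous_attains_inf[of "S \<inter> sphere 0 1" "\<lambda>x. B x x"] by blast
  then have x: "x \<in> S" "norm x = 1" by auto
  define l where "l = B x x"
  have low: "l * (z \<bullet> z) \<le> B z z" if "z \<in> S" for z
  proof (cases "z = 0")
    case False
    have "l \<le> B z z / (z \<bullet> z)"
      using min[OF unit[OF that False]]
      by (simp add: l_def B.scaleR_left B.scaleR_right norm_eq_square power2_eq_square
          flip: power2_norm_eq_inner)
    then show ?thesis using False by (simp add: field_simps)
  qed (simp add: B.zero_left)
  have "l * (\<theta> \<bullet> \<theta>) < 0" using low[OF S(2)] neg by linarith
  then have "l < 0" using inner_ge_zero[of \<theta>] by (auto simp: mult_less_0_iff)
  moreover have "B x y = l * (x \<bullet> y)" if y: "y \<in> S" for y
  proof -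
    \<comment> \<open>The lower bound \<open>low\<close> at \<open>x + t *\<^sub>R y\<close>; the
      constant terms cancel because \<open>B x x = l\<close> and \<open>norm x = 1\<close>.\<close>
    have "t * (2 * (l * (x \<bullet> y) - B x y)) \<le> t\<^sup>2 * (B y y - l * (y \<bullet> y))" for t
    proof -
      have "x + t *\<^sub>R y \<in> S" using S(1) x y by (simp add: subspace_add subspace_scale)
      from low[OF this] show ?thesis
        using x(2) sym[of y x]
        by (simp add: B.add_left B.add_right B.scaleR_left B.scaleR_right inner_add_left
            inner_add_right inner_commute[of y x] norm_eq_1 l_def[symmetric] algebra_simps power2_eq_square)
    qed
    then have "2 * (l * (x \<bullet> y) - B x y) = 0" by (rule linear_le_quadratic_imp_zero)
    then show ?thesis by simp
  qed
  ultimately show ?thesis using x by (metis norm_zero zero_neq_one)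
qed

text \<open>Polarization: the upper bound at \<open>b *\<^sub>R A + a *\<^sub>R B\<close> minus the
  lower bound at \<open>b *\<^sub>R A - a *\<^sub>R B\<close>. Both arguments have rank at most
  \<open>l\<close> since ranks are subadditive.\<close>

lemma restricted_hessian_form_polarized:
  fixes f :: "real^'p^'p \<Rightarrow> real"
  assumes f: "twice_cont_diff f" and rcs: "restricted_convex_smooth k l \<delta> f"
    and "0 \<le> \<delta>" and X: "rank X \<le> k" and AB: "rank A + rank B \<le> l"
  shows "hessian_form f X A B - A \<bullet> B \<le> \<delta> * (norm A * norm B)"
proof (cases "A = 0 \<or> B = 0")
  case True
  then show ?thesis
    using bilinear_lzero[OF bilinear_hessian_form[OF f]] bilinear_rzero[OF bilinear_hessian_form[OF f]]
    by auto
next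
  case False
  interpret H: bounded_bilinear "hessian_form f X"
    using bilinear_hessian_form[OF f] by (simp add: bilinear_conv_bounded_bilinear)
  \<comment> \<open>Weighting each matrix by the norm of the other balances the summands, so the
    error is the product of the norms.\<close>
  define a b where "a = norm A" and "b = norm B"
  have ab: "a > 0" "b > 0" using False by (auto simp: a_def b_def)
  have AA: "A \<bullet> A = a\<^sup>2" "B \<bullet> B = b\<^sup>2" by (simp_all add: a_def b_def power2_norm_eq_inner)
  have rk: "rank (b *\<^sub>R A + c *\<^sub>R B) \<le> l" for c
    using order_trans[OF rank_add_le add_mono[OF rank_scaleR_le rank_scaleR_le]] AB
    by (rule order_trans)
  have q: "(1 - \<delta>) * (C \<bullet> C) \<le> hessian_form f X C C" "hessian_form f X C C \<le> (1 + \<delta>) * (C \<bullet> C)"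
    if "rank C \<le> l" for C
    using rcs X that unfolding restricted_convex_smooth_def power2_norm_eq_inner by blast+
  define h where "h = hessian_form f X A B"
  have sym: "hessian_form f X B A = h" unfolding h_def by (rule hessian_form_sym[OF f])
  have "(1 - \<delta>) * (2 * a\<^sup>2 * b\<^sup>2 - 2 * (a * b) * (A \<bullet> B))
      \<le> b\<^sup>2 * hessian_form f X A A + a\<^sup>2 * hessian_form f X B B - 2 * (a * b) * h"
    using q(1)[OF rk, of "- a"] AA sym
    by (simp add: H.add_left H.add_right H.scaleR_left H.scaleR_right H.minus_left H.minus_right
        H.diff_left H.diff_right
        inner_add_left inner_add_right inner_diff_left inner_diff_right inner_commute[of B A]
        h_def[symmetric] algebra_simps power2_eq_square)
  moreover have "b\<^sup>2 * hessian_form f X A A + a\<^sup>2 * hessian_form f X B B + 2 * (a * b) * h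
      \<le> (1 + \<delta>) * (2 * a\<^sup>2 * b\<^sup>2 + 2 * (a * b) * (A \<bullet> B))"
    using q(2)[OF rk, of a] AA sym
    by (simp add: H.add_left H.add_right H.scaleR_left H.scaleR_right
        inner_add_left inner_add_right inner_commute[of B A]
        h_def[symmetric] algebra_simps power2_eq_square)
  ultimately have "(a * b) * (h - A \<bullet> B) \<le> (a * b) * (\<delta> * (a * b))"
    by (simp add: algebra_simps power2_eq_square)
  then show ?thesis
    using ab by (simp add: h_def a_def b_def)
qed

subsection \<open>Spectral norm and singular values\<close>

lemma spectral_norm_nonneg: "0 \<le> spectral_norm A"
  unfolding spectral_norm_def by (intro onorm_pos_le matrix_vector_mul_bounded_linear)

text \<open>The squared Frobenius norm splits over columns, and the operator norm bounds each
  column.\<close>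

lemma norm_matrix_mult_le_spectral:
  fixes A :: "real^'n^'m" and B :: "real^'k^'n"
  shows "norm (A ** B) \<le> spectral_norm A * norm B"
proof -
  have cols: "(norm C)\<^sup>2 = (\<Sum>j\<in>UNIV. (norm (column j C))\<^sup>2)" for C :: "real^'k^'l"
  proof -
    have "(norm C)\<^sup>2 = (\<Sum>j\<in>UNIV. transpose C $ j \<bullet> transpose C $ j)"
      by (subst norm_transpose[symmetric])
        (simp add: power2_norm_eq_inner inner_vec_def[of "transpose C"])
    then show ?thesis
      by (simp add: power2_norm_eq_inner transpose_def column_def)
  qed
  have onorm: "norm (A *v x) \<le> spectral_norm A * norm x" for x
    unfolding spectral_norm_def by (intro onorm matrix_vector_mul_bounded_linear)
  have "(norm (A ** B))\<^sup>2 = (\<Sum>j\<in>UNIV. (norm (A *v column j B))\<^sup>2)"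
    unfolding cols
    by (intro sum.cong refl arg_cong[where f = "\<lambda>x. (norm x)\<^sup>2"])
      (simp add: column_def matrix_matrix_mult_def matrix_vector_mult_def vec_eq_iff)
  also have "\<dots> \<le> (\<Sum>j\<in>UNIV. (spectral_norm A * norm (column j B))\<^sup>2)"
    by (intro sum_mono power_mono onorm) simp
  also have "\<dots> = (spectral_norm A * norm B)\<^sup>2"
    by (simp add: power_mult_distrib cols[of B] sum_distrib_left)
  finally show ?thesis
    by (rule power2_le_imp_le) (simp add: spectral_norm_nonneg)
qed

lemma norm_mult_transpose_self_le:
  fixes A :: "real^'r^'p"
  shows "norm (A ** transpose A) \<le> (norm A)\<^sup>2"
proof -
  have "spectral_norm A \<le> norm A"
    unfolding spectral_norm_def
  proof (rule onorm_bound)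
    fix x :: "real^'r"
    have "(norm (A *v x))\<^sup>2 = (\<Sum>i\<in>UNIV. (A $ i \<bullet> x)\<^sup>2)"
      unfolding power2_norm_eq_inner inner_vec_def[of "A *v x"]
      by (simp add: matrix_mult_dot power2_eq_square)
    also have "\<dots> \<le> (\<Sum>i\<in>UNIV. (norm (A $ i))\<^sup>2 * (norm x)\<^sup>2)"
      by (intro sum_mono) (simp add: Cauchy_Schwarz_ineq power2_norm_eq_inner)
    also have "\<dots> = (norm A * norm x)\<^sup>2"
      by (simp add: power_mult_distrib power2_norm_eq_inner inner_vec_def[of A] sum_distrib_right)
    finally show "norm (A *v x) \<le> norm A * norm x"
      by (rule power2_le_imp_le) simp
  qed simp
  then have "spectral_norm A * norm A \<le> norm A * norm A"
    by (intro mult_right_mono) auto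
  then have "norm (A ** transpose A) \<le> norm A * norm A"
    using norm_matrix_mult_le_spectral[of A "transpose A"] by (simp add: norm_transpose)
  then show ?thesis by (simp add: power2_eq_square)
qed

section \<open>Diagonal matrices and singular values for a diagonal Gram matrix\<close>

lemma diag_mat_mult_nth: "(diag_mat s ** B) $ i = s $ i *\<^sub>R B $ i"
  by (simp add: diag_mat_def matrix_matrix_mult_def vec_eq_iff mult_delta_left)

lemma diag_mat_mult: "diag_mat a ** diag_mat b = diag_mat (\<chi> i. a $ i * b $ i)"
  unfolding vec_eq_iff[of "diag_mat a ** diag_mat b"] diag_mat_mult_nth
  by (simp add: diag_mat_def vec_eq_iff)

lemma diag_mat_mult_vec: "(diag_mat s *v v) $ i = s $ i * v $ i"
  by (simp add: diag_mat_def matrix_vector_mult_def mult_delta_left)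

lemma transpose_diag_mat: "transpose (diag_mat s) = diag_mat s"
  by (auto simp: diag_mat_def transpose_def vec_eq_iff)

text \<open>Supplies uniqueness for the definite description in
  \<open>singular_values\<close>.\<close>

lemma sorted_desc_count_list_unique:
  fixes xs ys :: "'a::linorder list"
  assumes "sorted_wrt (\<ge>) xs" "sorted_wrt (\<ge>) ys" "\<And>x. count_list xs x = count_list ys x"
  shows "xs = ys"
proof -
  have "sorted (rev xs)" "sorted (rev ys)"
    using assms(1,2) by (simp_all add: sorted_wrt_rev)
  moreover have "mset (rev xs) = mset (rev ys)"
    using assms(3) by (simp add: multiset_eq_iff count_mset)
  ultimately have "rev xs = rev ys" by (metis properties_for_sort)
  then show ?thesis by simp
qed

text \<open>The eigenspace for the square of \<open>t\<close> is the coordinate subspace on the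
  indices with \<open>sqrt (s $ i) = t\<close>, so its dimension counts those indices. The sorted
  list of the square roots therefore meets the definition.\<close>

lemma singular_values_of_diagonal_gram:
  fixes A :: "real^'r^'p" and s :: "real^'r"
  assumes gram: "transpose A ** A = diag_mat s" and s: "\<And>i. 0 \<le> s $ i"
  shows "sorted_wrt (\<ge>) (singular_values A)" and "length (singular_values A) = CARD('r)"
    and "set (singular_values A) = range (\<lambda>i. sqrt (s $ i))"
proof -
  obtain js :: "'r list" where js: "set js = UNIV" "distinct js"
    using finite_distinct_list[OF finite] by blast
  define xs where "xs = rev (sort (map (\<lambda>i. sqrt (s $ i)) js))"
  have count: "count_list xs t = card {i. sqrt (s $ i) = t}" for t
  proof -
    have "count_list xs t = count_list (map (\<lambda>i. sqrt (s $ i)) js) t"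
      by (simp add: xs_def flip: count_mset)
    also have "\<dots> = length (filter (\<lambda>i. sqrt (s $ i) = t) js)"
      by (simp add: count_list_eq_length_filter filter_map o_def eq_commute)
    also have "\<dots> = card {i. sqrt (s $ i) = t}"
      using js by (simp flip: distinct_card)
    finally show ?thesis .
  qed
  have eigen: "dim {v. (transpose A ** A) *v v = t\<^sup>2 *\<^sub>R v} = card {i. sqrt (s $ i) = t}"
    if "0 \<le> t" for t
  proof -
    have "sqrt (s $ i) = t \<longleftrightarrow> s $ i = t\<^sup>2" for i
      using s[of i] that by auto
    then have "{v. (transpose A ** A) *v v = t\<^sup>2 *\<^sub>R v}
        = {v. \<forall>i. i \<notin> {i. sqrt (s $ i) = t} \<longrightarrow> v $ i = 0}"
      by (auto simp: gram vec_eq_iff diag_mat_mult_vec)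
    then show ?thesis
      using dim_substandard_cart[of "{i. sqrt (s $ i) = t}", where ?'a = real]
      by (simp only: dim_vec_eq)
  qed
  have neg: "card {i. sqrt (s $ i) = t} = 0" if "\<not> 0 \<le> t" for t
    using s that by (auto simp: card_eq_0_iff)
  have "singular_values A = xs"
    unfolding singular_values_def
  proof (rule the_equality)
    show "sorted_wrt (\<ge>) xs \<and> (\<forall>t. count_list xs t =
        (if 0 \<le> t then dim {v. (transpose A ** A) *v v = t\<^sup>2 *\<^sub>R v} else 0))"
      by (simp add: count eigen neg) (simp add: xs_def sorted_wrt_rev)
    then show "ys = xs" if "sorted_wrt (\<ge>) ys \<and> (\<forall>t. count_list ys t =
        (if 0 \<le> t then dim {v. (transpose A ** A) *v v = t\<^sup>2 *\<^sub>R v} else 0))" for ys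
      using that by (intro sorted_desc_count_list_unique) auto
  qed
  moreover have "length js = CARD('r)" using js by (metis distinct_card)
  ultimately show "sorted_wrt (\<ge>) (singular_values A)" "length (singular_values A) = CARD('r)"
    "set (singular_values A) = range (\<lambda>i. sqrt (s $ i))"
    using js by (simp_all add: xs_def sorted_wrt_rev)
qed

lemma sing_val_of_diagonal_gram:
  fixes A :: "real^'r^'p" and s :: "real^'r"
  assumes gram: "transpose A ** A = diag_mat s" and s: "\<And>i. 0 < s $ i"
  shows "0 < sing_val 1 A" and "0 < sing_val CARD('r) A" and "(sing_val CARD('r) A)\<^sup>2 \<le> s $ i"
proof -
  let ?xs = "singular_values A"
  note sv = singular_values_of_diagonal_gram[OF gram less_imp_le[OF s]]
  have pos: "0 < CARD('r)" by simp
  have "0 < ?xs ! k" if "k < CARD('r)" for k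
  proof -
    have "?xs ! k \<in> range (\<lambda>i. sqrt (s $ i))" using sv that by (metis nth_mem)
    then show ?thesis using s by auto
  qed
  then show "0 < sing_val 1 A" and last: "0 < sing_val CARD('r) A"
    using pos by (simp_all add: sing_val_def)
  obtain k where k: "k < CARD('r)" "?xs ! k = sqrt (s $ i)"
    using sv by (metis in_set_conv_nth rangeI)
  \<comment> \<open>\<open>sing_val\<close> counts from 1, so index \<open>CARD('r)\<close> is the
    last and smallest entry.\<close>
  have "?xs ! (CARD('r) - 1) \<le> ?xs ! k"
  proof (cases "k = CARD('r) - 1")
    case False
    then show ?thesis
      using k(1) sv(1,2) by (intro sorted_wrt_nth_less[of "(\<ge>)"]) auto
  qed simp
  then have "(sing_val CARD('r) A)\<^sup>2 \<le> (sqrt (s $ i))\<^sup>2"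
    using last k(2) by (intro power_mono) (auto simp: sing_val_def)
  then show "(sing_val CARD('r) A)\<^sup>2 \<le> s $ i" using s[of i] by simp
qed

text \<open>A diagonal Gram matrix weights the squared norms of the rows of \<open>B\<close> by the
  entries of \<open>s\<close>.\<close>

lemma norm_mult_diagonal_gram_ge:
  fixes A :: "real^'r^'p" and s :: "real^'r" and B :: "real^'q^'r"
  assumes gram: "transpose A ** A = diag_mat s" and c: "\<And>i. c \<le> s $ i"
  shows "c * (norm B)\<^sup>2 \<le> (norm (A ** B))\<^sup>2"
proof -
  have "(norm (A ** B))\<^sup>2 = B \<bullet> (diag_mat s ** B)"
    by (simp add: power2_norm_eq_inner inner_mult_left gram matrix_mul_assoc)
  also have "\<dots> = (\<Sum>i\<in>UNIV. s $ i * (B $ i \<bullet> B $ i))"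
    by (simp add: inner_vec_def[of B] diag_mat_mult_nth)
  also have "\<dots> \<ge> (\<Sum>i\<in>UNIV. c * (B $ i \<bullet> B $ i))"
    by (intro sum_mono mult_right_mono c) simp
  also have "(\<Sum>i\<in>UNIV. c * (B $ i \<bullet> B $ i)) = c * (norm B)\<^sup>2"
    by (simp add: power2_norm_eq_inner inner_vec_def[of B] sum_distrib_left)
  finally show ?thesis .
qed

text \<open>Turns the distance condition of \<open>region2\<close> into a lower bound on the norm of
  the Procrustes difference.\<close>

lemma procrustes_attains_quot_dist:
  assumes "is_arg_min (\<lambda>R. norm (A ** R - B)) orthogonal_matrix Q"
  shows "quot_dist B A = norm (A ** Q - B)"
  unfolding quot_dist_def
proof (rule cInf_eq_minimum)
  show "norm (A ** Q - B) \<in> (\<lambda>Q. norm (A ** Q - B)) ` {Q. orthogonal_matrix Q}"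
    using assms by (auto simp: is_arg_min_def)
qed (use assms in \<open>auto simp: is_arg_min_linorder\<close>)

subsection \<open>Negative curvature\<close>

lemma outer_difference:
  fixes Y Z :: "real^'r^'p"
  defines "\<theta> \<equiv> Y - Z" and "\<Delta> \<equiv> Y ** transpose Y - Z ** transpose Z"
  shows "Y ** transpose \<theta> + \<theta> ** transpose Y = \<Delta> + \<theta> ** transpose \<theta>"
  by (simp add: \<theta>_def \<Delta>_def transpose_linear matrix_mult_linear)

lemma inner_outer_lifted_grad_H:
  fixes Y \<theta> :: "real^'r^'p"
  assumes "transpose Xs = Xs"
  shows "(Y ** transpose \<theta> + \<theta> ** transpose Y) \<bullet> (Y ** transpose Y - Xs) = \<theta> \<bullet> lifted_grad_H Xs Y"
  by (simp add: inner_outer assms lifted_grad_H_def transpose_linear flip: scaleR_2)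
    (simp add: matrix_mult_linear)

text \<open>The left-hand side is the Hessian form of \<open>H_obj (Z ** transpose Z)\<close> at \<open>Y\<close> in the
  direction \<open>\<theta>\<close>.\<close>

lemma procrustes_curvature_le:
  fixes Y Z :: "real^'r^'p"
  assumes psd: "sym_psd (transpose Z ** Y)"
  defines "\<theta> \<equiv> Y - Z" and "\<Delta> \<equiv> Y ** transpose Y - Z ** transpose Z"
  shows "(norm (Y ** transpose \<theta> + \<theta> ** transpose Y))\<^sup>2 + 2 * (\<Delta> \<bullet> (\<theta> ** transpose \<theta>))
    \<le> 4 * (\<theta> \<bullet> lifted_grad_H (Z ** transpose Z) Y)
      - 2 * (sqrt 2 - 1) * (norm (Z ** transpose \<theta>))\<^sup>2"
proof -
  define M where "M = Y ** transpose \<theta> + \<theta> ** transpose Y"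
  define W where "W = \<theta> ** transpose \<theta>"
  have M: "M = \<Delta> + W" by (simp only: M_def W_def \<theta>_def \<Delta>_def outer_difference)
  have "M \<bullet> \<Delta> = \<theta> \<bullet> lifted_grad_H (Z ** transpose Z) Y"
    unfolding M_def \<Delta>_def by (rule inner_outer_lifted_grad_H) (simp add: transpose_linear)
  then have grad: "\<theta> \<bullet> lifted_grad_H (Z ** transpose Z) Y = \<Delta> \<bullet> \<Delta> + \<Delta> \<bullet> W"
    by (simp add: M inner_add_left inner_commute[of W])
  have "(norm M)\<^sup>2 + 2 * (\<Delta> \<bullet> W) = W \<bullet> W - 3 * (\<Delta> \<bullet> \<Delta>) + 4 * (\<theta> \<bullet> lifted_grad_H (Z ** transpose Z) Y)"
    unfolding grad by (simp add: M power2_norm_eq_inner inner_add_left inner_add_right inner_commute)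
  \<comment> \<open>The first bound reduces
    \<open>W \<bullet> W - 3 * (\<Delta> \<bullet> \<Delta>)\<close> to at most
    \<open>- (\<Delta> \<bullet> \<Delta>)\<close>, which the second bound then estimates.\<close>
  moreover have "W \<bullet> W \<le> 2 * (\<Delta> \<bullet> \<Delta>)"
    and "2 * (sqrt 2 - 1) * (norm (Z ** transpose \<theta>))\<^sup>2 \<le> \<Delta> \<bullet> \<Delta>"
    using procrustes_gap[OF psd] by (simp_all add: W_def \<theta>_def \<Delta>_def power2_norm_eq_inner)
  ultimately show ?thesis unfolding M_def W_def by linarith
qed

text \<open>The first two terms on the right are the Hessian form of
  \<open>H_obj (Z ** transpose Z)\<close>. The last collects the errors: \<open>\<delta>\<close>
  from the quadratic part and from the gradient along the segment, and \<open>norm G\<close> from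
  the gradient at the target.\<close>

lemma lifted_hess_h_le:
  fixes f :: "real^'p^'p \<Rightarrow> real" and Y Z :: "real^'r^'p"
  assumes f: "twice_cont_diff f"
    and rcs: "restricted_convex_smooth (2 * CARD('r)) (4 * CARD('r)) \<delta> f" and \<delta>: "0 \<le> \<delta>"
    and G: "best_rank_approx CARD('r) (gradient f (Z ** transpose Z)) G"
  defines "\<Delta> \<equiv> Y ** transpose Y - Z ** transpose Z"
  shows "lifted_hess_h f Y \<theta> \<theta> \<le> (norm (Y ** transpose \<theta> + \<theta> ** transpose Y))\<^sup>2
      + 2 * (\<Delta> \<bullet> (\<theta> ** transpose \<theta>))
      + (2 * \<delta> * (2 * (spectral_norm Y)\<^sup>2 + norm \<Delta>) + 2 * norm G) * (norm \<theta>)\<^sup>2"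
proof -
  define M where "M = Y ** transpose \<theta> + \<theta> ** transpose Y"
  define W where "W = \<theta> ** transpose \<theta>"
  let ?X = "Y ** transpose Y" and ?Xs = "Z ** transpose Z"
  have rX: "rank ?X \<le> CARD('r)" "rank ?Xs \<le> CARD('r)" "rank W \<le> CARD('r)"
    unfolding W_def by (rule rank_mult_le_inner)+
  have rM: "rank M \<le> 2 * CARD('r)"
    unfolding M_def
    using rank_add_le[of "Y ** transpose \<theta>" "\<theta> ** transpose Y"]
      rank_mult_le_inner[of Y "transpose \<theta>"] rank_mult_le_inner[of \<theta> "transpose Y"] by linarith
  have r\<Delta>: "rank \<Delta> \<le> 2 * CARD('r)"
    using rank_add_le[of ?X "(- 1) *\<^sub>R ?Xs"] rank_scaleR_le[of "- 1" ?Xs] rX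
    by (simp add: \<Delta>_def)
  have normW: "norm W \<le> (norm \<theta>)\<^sup>2"
    unfolding W_def by (rule norm_mult_transpose_self_le)
  have normM: "norm M \<le> 2 * (spectral_norm Y * norm \<theta>)"
  proof -
    have "norm (\<theta> ** transpose Y) = norm (Y ** transpose \<theta>)"
      using norm_transpose[of "Y ** transpose \<theta>"] by (simp add: transpose_linear)
    moreover have "norm (Y ** transpose \<theta>) \<le> spectral_norm Y * norm \<theta>"
      using norm_matrix_mult_le_spectral[of Y "transpose \<theta>"] by (simp add: norm_transpose)
    ultimately show ?thesis
      unfolding M_def using norm_triangle_ineq[of "Y ** transpose \<theta>" "\<theta> ** transpose Y"] by linarith
  qed
  have "hessian_form f ?X M M \<le> (1 + \<delta>) * (norm M)\<^sup>2"
    using rcs rX(1) rM unfolding restricted_convex_smooth_def by (simp add: mult_2)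
  moreover have "\<delta> * (norm M)\<^sup>2 \<le> \<delta> * (4 * (spectral_norm Y)\<^sup>2 * (norm \<theta>)\<^sup>2)"
    using power_mono[OF normM norm_ge_zero, of 2] \<delta>
    by (intro mult_left_mono) (simp_all add: power_mult_distrib)
  ultimately have quad: "hessian_form f ?X M M
      \<le> (norm M)\<^sup>2 + \<delta> * (4 * (spectral_norm Y)\<^sup>2 * (norm \<theta>)\<^sup>2)"
    by (simp add: algebra_simps)
  obtain t where "t \<in> {0<..<1}"
    and "(gradient f (?Xs + \<Delta>) - gradient f ?Xs) \<bullet> W = hessian_form f (?Xs + t *\<^sub>R \<Delta>) \<Delta> W"
    using gradient_mvt[OF f] by blast
  then have mvt: "gradient f ?X \<bullet> W = gradient f ?Xs \<bullet> W + hessian_form f (?Xs + t *\<^sub>R \<Delta>) \<Delta> W"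
    by (simp add: \<Delta>_def inner_diff_left)
  \<comment> \<open>Each point of the segment combines two matrices of rank at most
    \<open>CARD('r)\<close>, so the restricted bounds apply at the intermediate point.\<close>
  have "?Xs + t *\<^sub>R \<Delta> = t *\<^sub>R ?X + (1 - t) *\<^sub>R ?Xs"
    by (simp add: \<Delta>_def algebra_simps)
  then have "rank (?Xs + t *\<^sub>R \<Delta>) \<le> 2 * CARD('r)"
    using rank_add_le[of "t *\<^sub>R ?X" "(1 - t) *\<^sub>R ?Xs"] rank_scaleR_le[of t ?X]
      rank_scaleR_le[of "1 - t" ?Xs] rX by simp
  \<comment> \<open>The ranks of \<open>\<Delta>\<close> and \<open>W\<close> add up to at most
    \<open>3 * CARD('r)\<close>, within the allowed \<open>4 * CARD('r)\<close>.\<close>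
  then have "hessian_form f (?Xs + t *\<^sub>R \<Delta>) \<Delta> W - \<Delta> \<bullet> W \<le> \<delta> * (norm \<Delta> * norm W)"
    using r\<Delta> rX by (intro restricted_hessian_form_polarized[OF f rcs \<delta>]) auto
  moreover have "\<delta> * (norm \<Delta> * norm W) \<le> \<delta> * (norm \<Delta> * (norm \<theta>)\<^sup>2)"
    using \<delta> normW by (intro mult_left_mono) auto
  moreover have "gradient f ?Xs \<bullet> W \<le> norm G * norm W"
    using G rX(3) by (rule inner_le_best_rank_approx)
  moreover have "norm G * norm W \<le> norm G * (norm \<theta>)\<^sup>2"
    using normW by (intro mult_left_mono) auto
  ultimately have "gradient f ?X \<bullet> W \<le> \<Delta> \<bullet> W + \<delta> * (norm \<Delta> * (norm \<theta>)\<^sup>2) + norm G * (norm \<theta>)\<^sup>2"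
    using mvt by linarith
  with quad show ?thesis
    unfolding lifted_hess_h_diag M_def[symmetric] W_def[symmetric]
    by (simp add: algebra_simps)
qed

lemma subspace_horizontal: "subspace (horizontal Y)"
  unfolding horizontal_def subspace_def
  by (auto simp: transpose_linear matrix_mult_linear)

lemma reduced_eigendecomp_sqrt:
  fixes U Ys :: "real^'r^'p"
  assumes "reduced_eigendecomp Xs U s" and Ys: "Ys = U ** diag_mat (\<chi> i. sqrt (s $ i))"
  shows "Xs = Ys ** transpose Ys" and "transpose Ys ** Ys = diag_mat s"
proof -
  let ?S = "diag_mat (\<chi> i. sqrt (s $ i))"
  have U: "transpose U ** U = mat 1" and s: "\<And>i. 0 < s $ i" and Xs: "Xs = U ** diag_mat s ** transpose U"
    using assms(1) by (auto simp: reduced_eigendecomp_def)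
  have S: "?S ** ?S = diag_mat s"
    using s by (simp add: diag_mat_mult less_imp_le)
  have "Ys ** transpose Ys = U ** (?S ** ?S) ** transpose U"
    by (simp add: Ys transpose_linear transpose_diag_mat matrix_mul_assoc)
  then show "Xs = Ys ** transpose Ys" by (simp add: S Xs)
  have "transpose Ys ** Ys = ?S ** (transpose U ** U) ** ?S"
    by (simp add: Ys transpose_linear transpose_diag_mat matrix_mul_assoc)
  then show "transpose Ys ** Ys = diag_mat s" by (simp add: S U)
qed

theorem theorem4:
  fixes f :: "real^'p^'p \<Rightarrow> real"
    and Xs :: "real^'p^'p" and U :: "real^'r^'p" and s :: "real^'r"
    and Ys Y \<theta> :: "real^'r^'p" and Q :: "real^'r^'r" and G :: "real^'p^'p"
    and \<delta> \<mu> \<alpha> \<beta> \<gamma> :: real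
  assumes "CARD('r) \<le> CARD('p)"
    and "twice_cont_diff f"
    and "\<And>X. f X = f (transpose X)"
    and "0 \<le> \<delta>" and "\<delta> < 1"
    and "restricted_convex_smooth (2 * CARD('r)) (4 * CARD('r)) \<delta> f"
    and "sym_psd Xs" and "rank Xs = CARD('r)"
    and "reduced_eigendecomp Xs U s"
    and "Ys = U ** diag_mat (\<chi> i. sqrt (s $ i))"
    and "0 \<le> \<mu>" and "0 \<le> \<alpha>" and "0 \<le> \<beta>" and "0 \<le> \<gamma>"
    and "best_rank_approx CARD('r) (gradient f Xs) G"
    and "Y \<in> region2 Xs Ys \<mu> \<alpha> \<beta> \<gamma>"
    and "is_arg_min (\<lambda>R. norm (Ys ** R - Y)) orthogonal_matrix Q"
    and "\<theta> = Y - Ys ** Q"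
  shows "\<theta> \<in> horizontal Y \<and>
    lifted_hess_h f Y \<theta> \<theta> \<le>
      ((\<alpha> - 2 * (sqrt 2 - 1)) * (sing_val CARD('r) Ys)\<^sup>2
       + 2 * \<delta> * (2 * \<beta>\<^sup>2 * (spectral_norm Ys)\<^sup>2 + (1 + \<gamma>) * norm (Ys ** transpose Ys))
       + 2 * norm G) * (norm \<theta>)\<^sup>2 \<and>
    (\<alpha> < 2 * (sqrt 2 - 1) \<and>
     \<delta> \<le> (2 * (sqrt 2 - 1) - \<alpha>) * (sing_val CARD('r) Ys)\<^sup>2 /
          (8 * (2 * \<beta>\<^sup>2 * (spectral_norm Ys)\<^sup>2 + (1 + \<gamma>) * norm (Ys ** transpose Ys))) \<and>
     norm G \<le> (2 * (sqrt 2 - 1) - \<alpha>) / 8 * (sing_val CARD('r) Ys)\<^sup>2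
     \<longrightarrow>
     lifted_hess_h f Y \<theta> \<theta> \<le> (\<alpha> - 2 * (sqrt 2 - 1)) / 2 * (sing_val CARD('r) Ys)\<^sup>2 * (norm \<theta>)\<^sup>2 \<and>
     (\<alpha> - 2 * (sqrt 2 - 1)) / 2 * (sing_val CARD('r) Ys)\<^sup>2 * (norm \<theta>)\<^sup>2 < 0 \<and>
     (\<exists>l<0. hess_h_eigenvalue f Y l) \<and>
     escaping_direction f Y \<theta>)"
proof -
  note f = assms(2) and \<delta> = assms(4) and rcs = assms(6) and eig = assms(9,10)
    and opt = assms(17) and \<theta> = assms(18)
  define \<sigma> where "\<sigma> = sing_val CARD('r) Ys"
  define Z where "Z = Ys ** Q"
  define \<Delta> where "\<Delta> = Y ** transpose Y - Z ** transpose Z"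
  define b where "b = 2 * \<beta>\<^sup>2 * (spectral_norm Ys)\<^sup>2 + (1 + \<gamma>) * norm (Ys ** transpose Ys)"
  have Q: "orthogonal_matrix Q" using opt by (simp add: is_arg_min_def)
  have s: "\<And>i. 0 < s $ i" using eig(1) by (simp add: reduced_eigendecomp_def)
  note Xs = reduced_eigendecomp_sqrt(1)[OF eig] and gram = reduced_eigendecomp_sqrt(2)[OF eig]
  have \<sigma>1: "0 < sing_val 1 Ys" and \<sigma>: "0 < \<sigma>" and \<sigma>s: "\<And>i. \<sigma>\<^sup>2 \<le> s $ i"
    unfolding \<sigma>_def by (rule sing_val_of_diagonal_gram[OF gram s])+
  have "Z ** transpose Z = Ys ** (Q ** transpose Q) ** transpose Ys"
    by (simp add: Z_def transpose_linear matrix_mul_assoc)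
  then have ZZ: "Z ** transpose Z = Xs"
    using Q by (simp add: orthogonal_matrix_def Xs)
  have \<theta>Z: "\<theta> = Y - Z" by (simp add: \<theta> Z_def)
  have psd: "sym_psd (transpose Z ** Y)"
    unfolding Z_def by (rule procrustes_sym_psd[OF opt])
  have hor: "\<theta> \<in> horizontal Y"
    unfolding \<theta>Z using psd by (intro horizontal_procrustes) (simp add: sym_psd_def)
  have dist: "quot_dist Y Ys = norm \<theta>"
    using procrustes_attains_quot_dist[OF opt] by (simp add: \<theta> norm_minus_commute)
  \<comment> \<open>The distance threshold of the region. The gradient bound there equals
    \<open>\<alpha> * \<sigma>\<^sup>2 / 4\<close> times \<open>d\<close>, so
    \<open>d < norm \<theta>\<close> makes it linear in \<open>norm \<theta>\<close>.\<close>
  define d where "d = \<mu> * \<sigma> / cond_kappa Ys"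
  have d: "0 \<le> d" using assms(11) \<sigma> \<sigma>1 by (simp add: d_def cond_kappa_def \<sigma>_def)
  have reg: "d < norm \<theta>" "norm (lifted_grad_H Xs Y) \<le> \<alpha> * \<sigma>\<^sup>2 * d / 4"
    "spectral_norm Y \<le> \<beta> * spectral_norm Ys" "norm (Y ** transpose Y) \<le> \<gamma> * norm Xs"
    using assms(16)
    by (simp_all add: region2_def dist d_def \<sigma>_def Xs power2_eq_square power3_eq_cube mult_ac)
  have \<theta>pos: "0 < norm \<theta>" using d reg(1) by linarith

  \<comment> \<open>Upper bound on the Hessian form\<close>
  have "\<theta> \<bullet> lifted_grad_H Xs Y \<le> norm \<theta> * norm (lifted_grad_H Xs Y)"
    by (rule norm_cauchy_schwarz)
  also have "\<dots> \<le> norm \<theta> * (\<alpha> * \<sigma>\<^sup>2 * norm \<theta> / 4)"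
  proof (rule mult_left_mono)
    have "\<alpha> * \<sigma>\<^sup>2 * d \<le> \<alpha> * \<sigma>\<^sup>2 * norm \<theta>"
      using assms(12) reg(1) by (intro mult_left_mono) auto
    with reg(2) show "norm (lifted_grad_H Xs Y) \<le> \<alpha> * \<sigma>\<^sup>2 * norm \<theta> / 4" by linarith
  qed simp
  finally have grad: "4 * (\<theta> \<bullet> lifted_grad_H Xs Y) \<le> \<alpha> * \<sigma>\<^sup>2 * (norm \<theta>)\<^sup>2"
    by (simp add: power2_eq_square mult_ac)
  \<comment> \<open>\<open>Z ** transpose \<theta>\<close> equals
    \<open>Ys ** (Q ** transpose \<theta>)\<close>. Moving \<open>Q\<close> to the right factor
    leaves \<open>Ys\<close>, whose Gram matrix is diagonal.\<close>
  have "\<sigma>\<^sup>2 * (norm \<theta>)\<^sup>2 = \<sigma>\<^sup>2 * (norm (Q ** transpose \<theta>))\<^sup>2"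
    using norm_orthogonal_mult_right[of "transpose Q" \<theta>] Q norm_transpose[of "Q ** transpose \<theta>"]
    by (simp add: transpose_linear)
  also have "\<dots> \<le> (norm (Z ** transpose \<theta>))\<^sup>2"
    using norm_mult_diagonal_gram_ge[OF gram \<sigma>s, of "Q ** transpose \<theta>"]
    by (simp add: Z_def matrix_mul_assoc)
  finally have "2 * (sqrt 2 - 1) * (\<sigma>\<^sup>2 * (norm \<theta>)\<^sup>2) \<le> 2 * (sqrt 2 - 1) * (norm (Z ** transpose \<theta>))\<^sup>2"
    by (rule mult_left_mono) simp
  with procrustes_curvature_le[OF psd, folded \<theta>Z \<Delta>_def, unfolded ZZ] grad
  have curv: "(norm (Y ** transpose \<theta> + \<theta> ** transpose Y))\<^sup>2 + 2 * (\<Delta> \<bullet> (\<theta> ** transpose \<theta>))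
      \<le> \<alpha> * \<sigma>\<^sup>2 * (norm \<theta>)\<^sup>2 - 2 * (sqrt 2 - 1) * (\<sigma>\<^sup>2 * (norm \<theta>)\<^sup>2)"
    by linarith
  have "norm \<Delta> \<le> (1 + \<gamma>) * norm Xs"
    using norm_triangle_ineq4[of "Y ** transpose Y" Xs] reg(4)
    by (simp add: \<Delta>_def ZZ algebra_simps)
  moreover have "(spectral_norm Y)\<^sup>2 \<le> \<beta>\<^sup>2 * (spectral_norm Ys)\<^sup>2"
    using power_mono[OF reg(3) spectral_norm_nonneg, of 2] by (simp add: power_mult_distrib)
  ultimately have "2 * (spectral_norm Y)\<^sup>2 + norm \<Delta> \<le> b"
    by (simp add: b_def Xs)
  then have "(2 * \<delta> * (2 * (spectral_norm Y)\<^sup>2 + norm \<Delta>) + 2 * norm G) * (norm \<theta>)\<^sup>2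
      \<le> (2 * \<delta> * b + 2 * norm G) * (norm \<theta>)\<^sup>2"
    using \<delta> by (intro mult_right_mono add_right_mono mult_left_mono) auto
  moreover have "lifted_hess_h f Y \<theta> \<theta> \<le> (norm (Y ** transpose \<theta> + \<theta> ** transpose Y))\<^sup>2
      + 2 * (\<Delta> \<bullet> (\<theta> ** transpose \<theta>))
      + (2 * \<delta> * (2 * (spectral_norm Y)\<^sup>2 + norm \<Delta>) + 2 * norm G) * (norm \<theta>)\<^sup>2"
    unfolding \<Delta>_def using assms(15) by (intro lifted_hess_h_le[OF f rcs \<delta>]) (simp add: ZZ)
  ultimately have hess: "lifted_hess_h f Y \<theta> \<theta>
      \<le> ((\<alpha> - 2 * (sqrt 2 - 1)) * \<sigma>\<^sup>2 + 2 * \<delta> * b + 2 * norm G) * (norm \<theta>)\<^sup>2"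
    using curv by (simp add: algebra_simps)

  \<comment> \<open>Negative curvature under the smallness conditions\<close>
  have "lifted_hess_h f Y \<theta> \<theta> \<le> (\<alpha> - 2 * (sqrt 2 - 1)) / 2 * \<sigma>\<^sup>2 * (norm \<theta>)\<^sup>2 \<and>
      (\<alpha> - 2 * (sqrt 2 - 1)) / 2 * \<sigma>\<^sup>2 * (norm \<theta>)\<^sup>2 < 0 \<and>
      (\<exists>l<0. hess_h_eigenvalue f Y l) \<and> escaping_direction f Y \<theta>"
    if \<alpha>: "\<alpha> < 2 * (sqrt 2 - 1)"
      and \<delta>b: "\<delta> \<le> (2 * (sqrt 2 - 1) - \<alpha>) * \<sigma>\<^sup>2 / (8 * b)"
      and G: "norm G \<le> (2 * (sqrt 2 - 1) - \<alpha>) / 8 * \<sigma>\<^sup>2"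
  proof -
    define c where "c = (2 * (sqrt 2 - 1) - \<alpha>) * \<sigma>\<^sup>2"
    have c: "0 < c" using \<alpha> \<sigma> by (simp add: c_def)
    have "0 \<le> b" using assms(14) by (simp add: b_def)
    \<comment> \<open>Only \<open>0 \<le> b\<close> is at hand; for \<open>b = 0\<close> the left
      side vanishes while \<open>c\<close> is positive.\<close>
    then have "8 * (\<delta> * b) \<le> c"
      using \<delta>b[folded c_def] c by (cases "b = 0") (simp_all add: field_simps)
    \<comment> \<open>The two error terms take at most \<open>c / 4\<close> each, which leaves half
      of the negative term \<open>- c\<close>.\<close>
    then have "(\<alpha> - 2 * (sqrt 2 - 1)) * \<sigma>\<^sup>2 + 2 * \<delta> * b + 2 * norm G
        \<le> (\<alpha> - 2 * (sqrt 2 - 1)) / 2 * \<sigma>\<^sup>2"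
      using G by (simp add: c_def field_simps)
    then have "((\<alpha> - 2 * (sqrt 2 - 1)) * \<sigma>\<^sup>2 + 2 * \<delta> * b + 2 * norm G) * (norm \<theta>)\<^sup>2
        \<le> (\<alpha> - 2 * (sqrt 2 - 1)) / 2 * \<sigma>\<^sup>2 * (norm \<theta>)\<^sup>2"
      by (rule mult_right_mono) simp
    with hess have up: "lifted_hess_h f Y \<theta> \<theta> \<le> (\<alpha> - 2 * (sqrt 2 - 1)) / 2 * \<sigma>\<^sup>2 * (norm \<theta>)\<^sup>2"
      by linarith
    moreover have low: "(\<alpha> - 2 * (sqrt 2 - 1)) / 2 * \<sigma>\<^sup>2 * (norm \<theta>)\<^sup>2 < 0"
      using \<alpha> \<sigma> \<theta>pos by (intro mult_neg_pos) auto
    ultimately have neg: "lifted_hess_h f Y \<theta> \<theta> < 0" by linarith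
    moreover have "\<exists>l<0. hess_h_eigenvalue f Y l"
      unfolding hess_h_eigenvalue_def
      using exists_negative_eigenvalue[where B = "lifted_hess_h f Y" and S = "horizontal Y", OF
          bilinear_lifted_hess_h[OF f] lifted_hess_h_sym[OF f] subspace_horizontal hor neg] .
    ultimately show ?thesis using up low hor by (simp add: escaping_direction_def)
  qed
  with hor hess show ?thesis unfolding \<sigma>_def b_def by blast
qed

end
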